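(* Let $d$ be a positive integer. There exist a real-algebraic curve $\Gamma\subset\mathbb{R}^2$ of degree $d$ and a point $z\in\mathbb{R}^2$ such that all $d^2$ complex normals to $\Gamma$ passing through $z$ are, in fact, real. In other words, there exists $\Gamma$ of degree $d$ such that the $\mathbb{R}$-degree of its curve of normals $N_\Gamma$ equals $d^2$, which coincides with its complex degree.
   Context: A normal to a plane curve $\Gamma$ is an affine line perpendicular to the tangent line of $\Gamma$ at some point of $\Gamma$; complex normals are the normals at points of the complexification $\Gamma^{\mathbb{C}}\subset\mathbb{C}^2$, with perpendicularity taken with respect to the complexified bilinear form $x_1x_2+y_1y_2$. A real normal is a normal at a real point of $\Gamma$. The curve of normals $N_\Gamma$ is the curve in the dual projective plane whose points are the normals of $\Gamma$ (in the affine chart in which a line is written as $y+ux+v=0$, it is the set of the pairs $(u,v)$ corresponding to normals). The lines in the dual plane are the pencils of lines through a given point of the original plane, so that the intersection points of $N_\Gamma$ with the line dual to $z$ are the normals to $\Gamma$ through $z$. The $\mathbb{R}$-degree of a real algebraic hypersurface $H\subset\mathbb{R}^n$ is the supremum of the cardinality of $H\cap L$ taken over all real lines $L\subset\mathbb{R}^n$ that intersect $H$ transversally. The complex degree is the usual degree. *)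

theory Defs
  imports
    "HOL-Analysis.Analysis"
    "HOL-Computational_Algebra.Polynomial"
    "HOL-Library.Extended_Nat"
begin

section \<open>Plane algebraic sets\<close>

text \<open>
  A bivariate polynomial over \<^typ>\<open>'a\<close> is an element of \<^typ>\<open>'a poly poly\<close>: the outer
  variable is \<open>y\<close>, the inner one is \<open>x\<close>, so \<open>coeff (coeff f j) i\<close> is the coefficient of
  \<open>x^i * y^j\<close>.
\<close>

definition eval2 :: "'a::comm_ring_1 poly poly \<Rightarrow> 'a \<times> 'a \<Rightarrow> 'a" where
  "eval2 f p = poly (poly f [:snd p:]) (fst p)"

text \<open>The total degree; the zero polynomial gets degree 0.\<close>

definition total_degree :: "'a::comm_ring_1 poly poly \<Rightarrow> nat" where
  "total_degree f = (LEAST n. \<forall>i j. coeff (coeff f j) i \<noteq> 0 \<longrightarrow> i + j \<le> n)"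

definition partial_x :: "'a::idom poly poly \<Rightarrow> 'a poly poly" where
  "partial_x f = map_poly pderiv f"

definition partial_y :: "'a::idom poly poly \<Rightarrow> 'a poly poly" where
  "partial_y f = pderiv f"

definition vanishing_ideal :: "('a::comm_ring_1 \<times> 'a) set \<Rightarrow> 'a poly poly set" where
  "vanishing_ideal S = {g. \<forall>p\<in>S. eval2 g p = 0}"

text \<open>
  The Zariski closure of \<open>S\<close> is a plane curve exactly when the vanishing ideal of \<open>S\<close> is
  generated by a single nonconstant polynomial; the degree of the curve is the degree of that
  generator, which is unique up to a constant factor. \<open>S\<close> itself need not be Zariski closed.
\<close>

definition has_curve_degree :: "('a::comm_ring_1 \<times> 'a) set \<Rightarrow> nat \<Rightarrow> bool" where
  "has_curve_degree S n \<longleftrightarrow>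
     n > 0 \<and> (\<exists>f. vanishing_ideal S = {g. f dvd g} \<and> total_degree f = n)"

definition real_algebraic_curve :: "(real \<times> real) set \<Rightarrow> nat \<Rightarrow> bool" where
  "real_algebraic_curve \<Gamma> d \<longleftrightarrow>
     has_curve_degree \<Gamma> d \<and> (\<exists>f. \<Gamma> = {p. eval2 f p = 0})"


section \<open>Complexification, tangents and normals\<close>

definition complex_poly2 :: "real poly poly \<Rightarrow> complex poly poly" where
  "complex_poly2 f = map_poly (map_poly complex_of_real) f"

definition complex_point :: "real \<times> real \<Rightarrow> complex \<times> complex" where
  "complex_point p = (complex_of_real (fst p), complex_of_real (snd p))"

definition complexification :: "(real \<times> real) set \<Rightarrow> (complex \<times> complex) set" where
  "complexification \<Gamma> = {p. \<forall>g\<in>vanishing_ideal \<Gamma>. eval2 (complex_poly2 g) p = 0}"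

text \<open>The direction space of the Zariski tangent space of the complexification at \<open>p\<close>.\<close>

definition tangent_space ::
    "(real \<times> real) set \<Rightarrow> complex \<times> complex \<Rightarrow> (complex \<times> complex) set" where
  "tangent_space \<Gamma> p = {w. \<forall>g\<in>vanishing_ideal \<Gamma>.
     eval2 (partial_x (complex_poly2 g)) p * fst w +
     eval2 (partial_y (complex_poly2 g)) p * snd w = 0}"

text \<open>
  \<open>w\<close> spans the tangent line at \<open>p\<close>. Such a \<open>w\<close> exists only if the tangent space is
  one-dimensional, i.e. at a nonsingular point of the curve.
\<close>

definition tangent_direction ::
    "(real \<times> real) set \<Rightarrow> complex \<times> complex \<Rightarrow> complex \<times> complex \<Rightarrow> bool" where
  "tangent_direction \<Gamma> p w \<longleftrightarrow>
     w \<noteq> 0 \<and> tangent_space \<Gamma> p = range (\<lambda>c. (c * fst w, c * snd w))"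

text \<open>The complexified form is bilinear, not Hermitian: no complex conjugation.\<close>

definition bilinear_form :: "complex \<times> complex \<Rightarrow> complex \<times> complex \<Rightarrow> complex" where
  "bilinear_form a b = fst a * fst b + snd a * snd b"

definition normals_at ::
    "(real \<times> real) set \<Rightarrow> complex \<times> complex \<Rightarrow> (complex \<times> complex) set set" where
  "normals_at \<Gamma> p = {{q. bilinear_form (q - p) w = 0} | w. tangent_direction \<Gamma> p w}"

definition complex_normals :: "(real \<times> real) set \<Rightarrow> (complex \<times> complex) set set" where
  "complex_normals \<Gamma> = (\<Union>p\<in>complexification \<Gamma>. normals_at \<Gamma> p)"

text \<open>
  Real normals are also represented by their complex lines, so that they form a subset of the
  complex normals.
\<close>

definition real_normals :: "(real \<times> real) set \<Rightarrow> (complex \<times> complex) set set" where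
  "real_normals \<Gamma> = (\<Union>p\<in>\<Gamma>. normals_at \<Gamma> (complex_point p))"


section \<open>The curve of normals\<close>

definition dual_line :: "complex \<times> complex \<Rightarrow> (complex \<times> complex) set" where
  "dual_line p = {(x, y). y + fst p * x + snd p = 0}"

definition complex_curve_of_normals :: "(real \<times> real) set \<Rightarrow> (complex \<times> complex) set" where
  "complex_curve_of_normals \<Gamma> = {p. dual_line p \<in> complex_normals \<Gamma>}"

definition real_curve_of_normals :: "(real \<times> real) set \<Rightarrow> (real \<times> real) set" where
  "real_curve_of_normals \<Gamma> = {p. dual_line (complex_point p) \<in> real_normals \<Gamma>}"


section \<open>The real degree of a hypersurface\<close>

definition cardinality :: "'a set \<Rightarrow> enat" where
  "cardinality A = (if finite A then enat (card A) else \<infinity>)"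

definition affine_line :: "'a::real_vector \<Rightarrow> 'a \<Rightarrow> 'a set" where
  "affine_line a w = range (\<lambda>t. a + t *\<^sub>R w)"

text \<open>
  \<open>q\<close> is a nonsingular point of the hypersurface \<open>H\<close> and the direction \<open>w\<close> is not tangent to
  \<open>H\<close> at \<open>q\<close>: near \<open>q\<close>, \<open>H\<close> is the zero set of a polynomial \<open>F\<close> vanishing on all of \<open>H\<close>
  whose differential at \<open>q\<close> does not annihilate \<open>w\<close> (and in particular is nonzero).
\<close>

definition transversal_at :: "'a::euclidean_space set \<Rightarrow> 'a \<Rightarrow> 'a \<Rightarrow> bool" where
  "transversal_at H w q \<longleftrightarrow>
     (\<exists>F D U. real_polynomial_function F \<and> (\<forall>x\<in>H. F x = 0) \<and>
        open U \<and> q \<in> U \<and> H \<inter> U = {x \<in> U. F x = 0} \<and>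
        (F has_derivative D) (at q) \<and> D w \<noteq> 0)"

definition R_degree :: "'a::euclidean_space set \<Rightarrow> enat" where
  "R_degree H = Sup {cardinality (H \<inter> affine_line a w) | a w.
     w \<noteq> 0 \<and> (\<forall>q \<in> H \<inter> affine_line a w. transversal_at H w q)}"

end

theory Submission
  imports Defs "Jordan_Normal_Form.Determinant"
begin

text \<open>
  The curve \<open>\<Gamma>\<close> is a small perturbation of \<open>d\<close> lines in general
  position. The union of the lines has only \<open>d\<close> normals through \<open>z\<close>, one for
  each line, but each of its \<open>d (d - 1) / 2\<close> nodes is smoothed into a small hyperbola, and
  a hyperbola whose branches lie in the right pair of opposite sectors has a normal through
  \<open>z\<close> on each branch. Together these are \<open>d + d (d - 1) = d\<^sup>2\<close> real
  normals. The side to which a node is smoothed is prescribed node by node: if \<open>l\<^sub>k\<close>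
  are the equations of the lines, then \<open>\<Sum> w\<^sub>i\<^sub>j \<Prod>\<^bsub>k \<noteq> i,
  j\<^esub> l\<^sub>k\<close> takes at the node of \<open>l\<^sub>i\<close> and \<open>l\<^sub>j\<close>
  the value \<open>w\<^sub>i\<^sub>j \<Prod>\<^bsub>k \<noteq> i, j\<^esub> l\<^sub>k\<close> and has
  degree \<open>d - 2\<close>. Here \<open>z = (0, 0)\<close>, and the lines are \<open>y + \<beta> x =
  1 / \<beta>\<close> for \<open>\<beta> = 1, 2, 4, \<dots>\<close>. These are tangents of a parabola,
  hence no three of them meet; the line from \<open>z\<close> to the node of the lines
  \<open>\<beta>\<^sub>i\<close> and \<open>\<beta>\<^sub>j\<close> has slope \<open>- (\<beta>\<^sub>i
  + \<beta>\<^sub>j)\<close>, and these sums are distinct.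

  The real normals are found by a perturbation argument in two parameters \<open>(\<delta>,
  \<sigma>)\<close>: the equation is perturbed by \<open>\<delta>\<^sup>2\<close> times the sum above,
  and \<open>z\<close> moves to \<open>(0, \<delta> \<sigma>)\<close>. After zooming into a node by the
  factor \<open>1 / \<delta>\<close>, foot and slope of a normal are a zero of a system that depends
  smoothly on the parameters and has two nondegenerate zeros at \<open>\<delta> = \<sigma> = 0\<close>;
  such zeros persist (\<open>stable_zero\<close>, from Sussmann's open mapping theorem). So for one
  fixed small \<open>\<delta>\<close> there are \<open>d\<^sup>2\<close> real normals through
  \<^emph>\<open>every\<close> point \<open>(0, s)\<close> with \<open>s\<close> near 0
  (\<open>good_parameters\<close>).

  The upper bound is a polynomial \<open>R\<close> in the dual coordinates \<open>(u, v)\<close>, of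
  total degree at most \<open>d\<^sup>2\<close>, that vanishes on all complex normals: the resultant of
  the restrictions of \<open>F\<close> and of \<open>F\<^sub>y + u F\<^sub>x\<close> to the line
  \<open>y + u x + v = 0\<close> (\<open>normal_polynomial_exists\<close>).

  The two bounds determine everything else. On each of the infinitely many lines \<open>v = - s\<close>
  with small real \<open>s\<close>, the polynomial \<open>R\<close> has the maximal number
  \<open>d\<^sup>2\<close> of roots, and all of them are real normals. Division with remainder by
  \<open>R\<close> then shows that \<open>R\<close> generates the vanishing ideal of the curve of
  normals and has total degree exactly \<open>d\<^sup>2\<close>
  (\<open>principal_vanishing_ideal\<close>; the same lemma shows that \<open>F\<close> generates the
  ideal of \<open>\<Gamma>\<close>). Near the line \<open>v = 0\<close> the real curve of normals is the
  full real zero set of \<open>R\<close>, with simple roots on the line, so this line is transversal to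
  it.
\<close>

hide_const (open) module.smult

section \<open>Bivariate polynomials\<close>

lemma eval2_altdef:
  "eval2 f p = (\<Sum>j\<le>degree f. poly (coeff f j) (fst p) * snd p ^ j)"
  by (simp add: eval2_def poly_altdef[of f] poly_sum poly_mult poly_power)

lemma eval2_0 [simp]: "eval2 0 p = 0"
  and eval2_1 [simp]: "eval2 1 p = 1"
  and eval2_const [simp]: "eval2 [:[:c:]:] p = c"
  and eval2_add [simp]: "eval2 (f + g) p = eval2 f p + eval2 g p"
  and eval2_diff [simp]: "eval2 (f - g) p = eval2 f p - eval2 g p"
  and eval2_mult [simp]: "eval2 (f * g) p = eval2 f p * eval2 g p"
  by (simp_all add: eval2_def)

lemma eval2_sum [simp]: "eval2 (\<Sum>k\<in>A. f k) p = (\<Sum>k\<in>A. eval2 (f k) p)"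
  by (induction A rule: infinite_finite_induct) auto

lemma eval2_prod [simp]: "eval2 (\<Prod>k\<in>A. f k) p = (\<Prod>k\<in>A. eval2 (f k) p)"
  by (induction A rule: infinite_finite_induct) auto

lemma eval2_monom: "eval2 (monom (monom c i) j) (x, y) = c * x ^ i * y ^ j"
  by (simp add: eval2_def poly_monom poly_mult poly_power)

lemma poly_map_poly_eval: "poly (map_poly (\<lambda>c. poly c x) f) y = eval2 f (x, y)"
proof -
  have "poly (map_poly (\<lambda>c. poly c x) f) y = poly (poly f [:y:]) x"
    by (induction f) (auto simp: map_poly_pCons)
  thus ?thesis by (simp add: eval2_def)
qed

lemma eval2_eq_0_imp_0:
  fixes f :: "'a::field_char_0 poly poly"
  assumes "\<And>x y. eval2 f (x, y) = 0"
  shows "f = 0"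
proof (rule ccontr)
  assume "f \<noteq> 0"
  have "poly f [:y:] = 0" for y
    using assms[of _ y] poly_all_0_iff_0[of "poly f [:y:]"] by (auto simp: eval2_def)
  hence "range (\<lambda>y. [:y:]) \<subseteq> {q. poly f q = 0}" by auto
  hence "finite (range (\<lambda>y::'a. [:y:]))"
    using poly_roots_finite[OF \<open>f \<noteq> 0\<close>] finite_subset by blast
  moreover have "inj (\<lambda>y::'a. [:y:])" by (auto simp: inj_def)
  ultimately show False
    using infinite_UNIV_char_0[where 'a = 'a] finite_imageD by blast
qed

lemma eval2_inject:
  fixes f g :: "'a::field_char_0 poly poly"
  assumes "\<And>x y. eval2 f (x, y) = eval2 g (x, y)"
  shows "f = g"
  using eval2_eq_0_imp_0[of "f - g"] assms by simp

subsection \<open>Total degree\<close>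

definition total_degree_le :: "nat \<Rightarrow> 'a::comm_ring_1 poly poly \<Rightarrow> bool" where
  "total_degree_le n f \<longleftrightarrow> (\<forall>i j. coeff (coeff f j) i \<noteq> 0 \<longrightarrow> i + j \<le> n)"

lemma total_degree_leD: "total_degree_le n f \<Longrightarrow> n < i + j \<Longrightarrow> coeff (coeff f j) i = 0"
  by (force simp: total_degree_le_def)

lemma total_degree_le_mono: "total_degree_le m f \<Longrightarrow> m \<le> n \<Longrightarrow> total_degree_le n f"
  by (force simp: total_degree_le_def)

lemma total_degree_le_0 [simp]: "total_degree_le n 0"
  by (simp add: total_degree_le_def)

lemma total_degree_le_const [simp]: "total_degree_le n [:[:c:]:]"
  by (auto simp: total_degree_le_def coeff_pCons split: nat.splits)

lemma total_degree_le_1 [simp]: "total_degree_le n 1"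
  using total_degree_le_const[of n 1] by (simp add: one_pCons)

lemma total_degree_le_add:
  assumes "total_degree_le n f" "total_degree_le n g"
  shows "total_degree_le n (f + g)"
  unfolding total_degree_le_def
proof safe
  fix i j assume "coeff (coeff (f + g) j) i \<noteq> 0"
  hence "coeff (coeff f j) i \<noteq> 0 \<or> coeff (coeff g j) i \<noteq> 0" by auto
  thus "i + j \<le> n" using assms by (auto simp: total_degree_le_def)
qed

lemma total_degree_le_mult:
  assumes f: "total_degree_le m f" and g: "total_degree_le n g"
  shows "total_degree_le (m + n) (f * g)"
  unfolding total_degree_le_def
proof safe
  fix i j assume "coeff (coeff (f * g) j) i \<noteq> 0"
  hence "(\<Sum>a\<le>j. \<Sum>b\<le>i. coeff (coeff f a) b * coeff (coeff g (j - a)) (i - b)) \<noteq> 0"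
    by (simp add: coeff_mult coeff_sum)
  then obtain a where a: "a \<le> j"
      "(\<Sum>b\<le>i. coeff (coeff f a) b * coeff (coeff g (j - a)) (i - b)) \<noteq> 0"
    by (meson atMost_iff sum.not_neutral_contains_not_neutral)
  then obtain b where b: "b \<le> i" "coeff (coeff f a) b * coeff (coeff g (j - a)) (i - b) \<noteq> 0"
    by (meson atMost_iff sum.not_neutral_contains_not_neutral)
  hence "coeff (coeff f a) b \<noteq> 0" "coeff (coeff g (j - a)) (i - b) \<noteq> 0" by auto
  hence "b + a \<le> m" "(i - b) + (j - a) \<le> n"
    using f g by (auto simp: total_degree_le_def)
  thus "i + j \<le> m + n" using a b by linarith
qed

lemma total_degree_le_sum:
  "(\<And>k. k \<in> A \<Longrightarrow> total_degree_le n (f k)) \<Longrightarrow> total_degree_le n (\<Sum>k\<in>A. f k)"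
  by (induction A rule: infinite_finite_induct) (auto intro: total_degree_le_add)

lemma total_degree_le_prod:
  "(\<And>k. k \<in> A \<Longrightarrow> total_degree_le 1 (f k)) \<Longrightarrow> total_degree_le (card A) (\<Prod>k\<in>A. f k)"
proof (induction A rule: infinite_finite_induct)
  case (insert a A)
  thus ?case using total_degree_le_mult[of 1 "f a" "card A" "prod f A"] by simp
qed auto

lemma total_degree_eqI:
  assumes "total_degree_le n f" "coeff (coeff f j) i \<noteq> 0" "i + j = n"
  shows "total_degree f = n"
  unfolding total_degree_def
proof (rule Least_equality)
  show "\<forall>i j. coeff (coeff f j) i \<noteq> 0 \<longrightarrow> i + j \<le> n"
    using assms(1) by (simp add: total_degree_le_def)
qed (use assms in blast)

subsection \<open>Partial derivatives\<close>

lemma coeff_partial_x: "coeff (partial_x f) j = pderiv (coeff f j)"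
  by (simp add: partial_x_def coeff_map_poly)

lemma partial_x_add: "partial_x (f + g) = partial_x f + partial_x g"
  by (rule poly_eqI) (simp add: coeff_partial_x pderiv_add)

lemma partial_y_add: "partial_y (f + g) = partial_y f + partial_y g"
  by (simp add: partial_y_def pderiv_add)

lemma pderiv_sum: "pderiv (\<Sum>k\<in>A. f k) = (\<Sum>k\<in>A. pderiv (f k))"
  by (induction A rule: infinite_finite_induct) (auto simp: pderiv_add)

lemma coeff_of_nat_mult: "coeff (of_nat n * p) i = of_nat n * coeff p i"
  by (induction n) (auto simp: algebra_simps)

lemma coeff_partial_y: "coeff (coeff (partial_y f) j) i = of_nat (Suc j) * coeff (coeff f (Suc j)) i"
  by (simp only: partial_y_def coeff_pderiv coeff_of_nat_mult)

lemma partial_x_mult: "partial_x (f * g) = f * partial_x g + partial_x f * g"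
  by (rule poly_eqI)
     (simp add: coeff_partial_x coeff_mult pderiv_sum pderiv_mult sum.distrib
        mult.commute[of "coeff g _" "pderiv _"])

lemma partial_y_mult: "partial_y (f * g) = f * partial_y g + partial_y f * g"
  by (simp add: partial_y_def pderiv_mult algebra_simps)

lemma total_degree_le_partial_x:
  fixes f :: "'a::field_char_0 poly poly"
  shows "total_degree_le n f \<Longrightarrow> total_degree_le (n - 1) (partial_x f)"
  by (fastforce simp: total_degree_le_def coeff_partial_x coeff_pderiv)

lemma total_degree_le_partial_y:
  fixes f :: "'a::field_char_0 poly poly"
  assumes "total_degree_le n f"
  shows "total_degree_le (n - 1) (partial_y f)"
  unfolding total_degree_le_def
proof safe
  fix i j assume "coeff (coeff (partial_y f) j) i \<noteq> 0"
  hence "coeff (coeff f (Suc j)) i \<noteq> 0"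
    by (auto simp: coeff_partial_y simp del: of_nat_Suc)
  hence "i + Suc j \<le> n" using assms unfolding total_degree_le_def by blast
  thus "i + j \<le> n - 1" by simp
qed

subsection \<open>Exchanging the variables\<close>

definition swap_vars :: "'a::comm_ring_1 poly poly \<Rightarrow> 'a poly poly" where
  "swap_vars f = (\<Sum>j\<le>degree f. \<Sum>i\<le>degree (coeff f j). monom (monom (coeff (coeff f j) i) j) i)"

lemma eval2_swap_vars: "eval2 (swap_vars f) (x, y) = eval2 f (y, x)"
  by (simp add: swap_vars_def eval2_altdef[of f] eval2_monom poly_altdef sum_distrib_left
        sum_distrib_right mult_ac)

lemma swap_vars_swap_vars:
  fixes f :: "'a::field_char_0 poly poly"
  shows "swap_vars (swap_vars f) = f"
  by (rule eval2_inject) (simp add: eval2_swap_vars)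

lemma swap_vars_mult:
  fixes f g :: "'a::field_char_0 poly poly"
  shows "swap_vars (f * g) = swap_vars f * swap_vars g"
  by (rule eval2_inject) (simp add: eval2_swap_vars)

lemma coeff_swap_vars: "coeff (coeff (swap_vars f) j) i = coeff (coeff f i) j"
proof -
  have "coeff (coeff (swap_vars f) j) i =
        (\<Sum>b\<le>degree f. \<Sum>a\<le>degree (coeff f b). if a = j then if b = i then coeff (coeff f b) a else 0 else 0)"
    by (simp add: swap_vars_def coeff_sum if_distrib[of "\<lambda>p. coeff p i"] cong: if_cong)
  also have "\<dots> = (\<Sum>b\<le>degree f. if b = i then coeff (coeff f b) j else 0)"
    by (rule sum.cong) (auto simp: sum.delta coeff_eq_0 cong: if_cong)
  also have "\<dots> = coeff (coeff f i) j"
    by (auto simp: sum.delta coeff_eq_0)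
  finally show ?thesis .
qed

lemma total_degree_swap_vars: "total_degree (swap_vars f) = total_degree f"
  unfolding total_degree_def coeff_swap_vars by (rule arg_cong[where f = Least]) (metis add.commute)

lemma total_degree_le_swap_vars: "total_degree_le n (swap_vars f) \<longleftrightarrow> total_degree_le n f"
  unfolding total_degree_le_def coeff_swap_vars by (metis add.commute)

subsection \<open>Polynomial functions on lines\<close>

definition compose2 :: "'a::comm_ring_1 poly poly \<Rightarrow> 'a poly \<Rightarrow> 'a poly \<Rightarrow> 'a poly" where
  "compose2 f X Y = (\<Sum>j\<le>degree f. pcompose (coeff f j) X * Y ^ j)"

lemma poly_compose2: "poly (compose2 f X Y) t = eval2 f (poly X t, poly Y t)"
  by (simp add: compose2_def eval2_altdef poly_sum poly_pcompose)

lemma pcompose_compose2: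
  fixes f :: "'a::field_char_0 poly poly"
  shows "pcompose (compose2 f X Y) L = compose2 f (pcompose X L) (pcompose Y L)"
  by (subst poly_eq_poly_eq_iff[symmetric]) (simp add: fun_eq_iff poly_pcompose poly_compose2)

lemma degree_compose2_le:
  fixes f :: "'a::field_char_0 poly poly"
  assumes "total_degree_le n f" "degree X \<le> 1" "degree Y \<le> 1"
  shows "degree (compose2 f X Y) \<le> n"
  unfolding compose2_def
proof (intro degree_sum_le)
  fix j assume "j \<in> {..degree f}"
  show "degree (pcompose (coeff f j) X * Y ^ j) \<le> n"
  proof (cases "coeff f j = 0")
    case False
    hence "degree (coeff f j) + j \<le> n"
      using assms(1) by (auto simp: total_degree_le_def)
    moreover have "degree (pcompose (coeff f j) X) \<le> degree (coeff f j) * 1"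
      by (rule order.trans[OF degree_pcompose_le mult_le_mono2]) (fact assms(2))
    moreover have "degree (Y ^ j) \<le> 1 * j"
      by (rule order.trans[OF degree_power_le mult_le_mono1]) (fact assms(3))
    ultimately show ?thesis
      using degree_mult_le[of "pcompose (coeff f j) X" "Y ^ j"] by linarith
  qed simp
qed auto

subsection \<open>Complexification of coefficients\<close>

lemma coeff_complex_poly2:
  "coeff (coeff (complex_poly2 f) j) i = complex_of_real (coeff (coeff f j) i)"
  by (simp add: complex_poly2_def coeff_map_poly)

lemma complex_poly2_mult: "complex_poly2 (f * g) = complex_poly2 f * complex_poly2 g"
  by (intro poly_eqI) (simp add: coeff_complex_poly2 coeff_mult coeff_sum)

lemma partial_x_complex_poly2: "partial_x (complex_poly2 f) = complex_poly2 (partial_x f)"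
  by (intro poly_eqI) (simp add: coeff_complex_poly2 coeff_partial_x coeff_pderiv)

lemma partial_y_complex_poly2: "partial_y (complex_poly2 f) = complex_poly2 (partial_y f)"
  by (intro poly_eqI)
     (simp add: coeff_complex_poly2 coeff_partial_y)

lemma total_degree_le_complex_poly2: "total_degree_le n (complex_poly2 f) \<longleftrightarrow> total_degree_le n f"
  by (simp add: total_degree_le_def coeff_complex_poly2)

lemma eval2_complex_poly2:
  "eval2 (complex_poly2 f) (complex_point p) = complex_of_real (eval2 f p)"
proof -
  have "degree (complex_poly2 f) = degree f"
    unfolding complex_poly2_def by (rule degree_map_poly) (auto simp: map_poly_eq_0_iff)
  moreover have "coeff (complex_poly2 f) j = map_poly complex_of_real (coeff f j)" for j
    by (simp add: complex_poly2_def coeff_map_poly)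
  moreover have "poly (map_poly complex_of_real q) (of_real x) = of_real (poly q x)" for q x
    by (induction q) (auto simp: map_poly_pCons)
  ultimately show ?thesis
    by (simp add: eval2_altdef complex_point_def)
qed

lemma eval2_smult [simp]: "eval2 (smult [:c:] f) p = c * eval2 f p"
  by (simp add: eval2_def)

lemma partial_smult [simp]:
  "partial_x (smult [:c:] f) = smult [:c:] (partial_x f)"
  "partial_y (smult [:c:] f) = smult [:c:] (partial_y f)"
  by (auto intro!: poly_eqI simp: coeff_partial_x coeff_partial_y coeff_pderiv)

lemma total_degree_le_smult: "total_degree_le n f \<Longrightarrow> total_degree_le n (smult [:c:] f)"
  unfolding total_degree_le_def by simp (metis mult_zero_right)

section \<open>Principal vanishing ideals\<close>

text \<open>
  If \<open>f\<close> has total degree at most \<open>n\<close>, then the coefficient of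
  \<open>y\<^sup>n\<close> in \<open>f\<close> is a constant. A polynomial of \<open>y\<close>-degree
  less than \<open>n\<close> that vanishes on \<open>S\<close> has too many zeros in each of the
  infinitely many fibres, so it is zero. Applied to \<open>f\<close> this shows that the constant is
  nonzero; hence one can divide by \<open>f\<close>, and applied to the remainder it shows that
  \<open>f\<close> divides every polynomial that vanishes on \<open>S\<close>.
\<close>

lemma principal_vanishing_ideal:
  fixes f :: "'a::field_char_0 poly poly"
  assumes "f \<noteq> 0" and deg: "total_degree_le n f"
    and van: "\<And>p. p \<in> S \<Longrightarrow> eval2 f p = 0"
    and inf: "infinite X"
    and fibre: "\<And>x. x \<in> X \<Longrightarrow> \<exists>Y. finite Y \<and> card Y = n \<and> (\<forall>y\<in>Y. (x, y) \<in> S)"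
  shows "vanishing_ideal S = {g. f dvd g}" and "coeff (coeff f n) 0 \<noteq> 0"
    and "total_degree f = n"
proof -
  let ?at = "\<lambda>x g. map_poly (\<lambda>c. poly c x) (g :: 'a poly poly)"
  have small: "g = 0" if "g \<in> vanishing_ideal S" "degree g < n \<or> g = 0" for g
  proof -
    have "?at x g = 0" if "x \<in> X" for x
    proof (rule ccontr)
      assume nz: "?at x g \<noteq> 0"
      obtain Y where Y: "finite Y" "card Y = n" "\<forall>y\<in>Y. (x, y) \<in> S"
        using fibre[OF \<open>x \<in> X\<close>] by blast
      have "Y \<subseteq> {y. poly (?at x g) y = 0}"
        using Y(3) \<open>g \<in> vanishing_ideal S\<close> by (auto simp: poly_map_poly_eval vanishing_ideal_def)
      hence "n \<le> card {y. poly (?at x g) y = 0}"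
        using Y(2) card_mono[OF poly_roots_finite[OF nz]] by blast
      also have "\<dots> \<le> degree (?at x g)" by (rule card_poly_roots_bound[OF nz])
      also have "\<dots> \<le> degree g" by (rule map_poly_degree_leq)
      finally show False using \<open>degree g < n \<or> g = 0\<close> nz by auto
    qed
    hence "poly (coeff g j) x = 0" if "x \<in> X" for x j
      using that by (metis coeff_0 coeff_map_poly poly_0)
    hence "X \<subseteq> {x. poly (coeff g j) x = 0}" for j by auto
    hence "coeff g j = 0" for j
      using inf poly_roots_finite finite_subset by blast
    thus "g = 0" by (auto intro: poly_eqI)
  qed
  have "f \<in> vanishing_ideal S" using van by (auto simp: vanishing_ideal_def)
  hence "n \<le> degree f" using small[of f] \<open>f \<noteq> 0\<close> by (meson not_le)
  moreover have "degree f \<le> n"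
    using deg \<open>f \<noteq> 0\<close> unfolding total_degree_le_def
    by (metis add_leE leading_coeff_0_iff)
  ultimately have degf: "degree f = n" by simp
  have "degree (coeff f n) = 0"
    using deg \<open>f \<noteq> 0\<close> degf unfolding total_degree_le_def
    by (metis add_le_same_cancel2 le_zero_eq leading_coeff_0_iff)
  then obtain c where c: "coeff f n = [:c:]" by (metis degree_eq_zeroE)
  have "c \<noteq> 0" using c degf \<open>f \<noteq> 0\<close> by (metis leading_coeff_0_iff pCons_0_0)
  thus cn: "coeff (coeff f n) 0 \<noteq> 0" using c by simp
  show "total_degree f = n" using total_degree_eqI[OF deg cn] by simp
  show "vanishing_ideal S = {g. f dvd g}"
  proof safe
    fix g assume g: "g \<in> vanishing_ideal S"
    obtain q r where qr: "pseudo_divmod g f = (q, r)" by (cases "pseudo_divmod g f")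
    define k where "k = Suc (degree g) - degree f"
    have "smult (coeff f (degree f) ^ k) g = f * q + r"
      and r: "r = 0 \<or> degree r < degree f"
      using pseudo_divmod[OF \<open>f \<noteq> 0\<close> qr] by (auto simp: k_def)
    hence eq: "smult [:c ^ k:] g = f * q + r" using c degf by (simp add: poly_const_pow)
    have "eval2 (smult [:c ^ k:] g) p = c ^ k * eval2 g p" for p by (simp add: eval2_def)
    hence "eval2 r p = 0" if "p \<in> S" for p
      using that g van[OF that] arg_cong[OF eq, of "\<lambda>h. eval2 h p"]
      by (simp add: vanishing_ideal_def)
    hence "r = 0" using small[of r] r degf by (auto simp: vanishing_ideal_def)
    hence "smult [:inverse (c ^ k):] (smult [:c ^ k:] g) = f * smult [:inverse (c ^ k):] q"
      using eq by simp
    hence "g = f * smult [:inverse (c ^ k):] q" using \<open>c \<noteq> 0\<close> by (simp flip: one_pCons)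
    thus "f dvd g" by (rule dvdI)
  next
    fix g assume "f dvd g"
    thus "g \<in> vanishing_ideal S" using van by (auto simp: vanishing_ideal_def elim!: dvdE)
  qed
qed


section \<open>The Sylvester determinant\<close>

text \<open>
  The sizes \<open>m\<close> and \<open>n\<close> are bounds on the degrees of \<open>p\<close> and
  \<open>q\<close>, not the degrees: both polynomials will depend on parameters, and their leading
  coefficients may vanish. A row is the coefficient vector of a polynomial, so that the identities
  between rows below are identities between polynomials.
\<close>

definition sylvester_row :: "nat \<Rightarrow> 'a::comm_ring_1 poly \<Rightarrow> 'a poly \<Rightarrow> nat \<Rightarrow> 'a poly" where
  "sylvester_row n p q r = (if r < n then monom 1 r * p else monom 1 (r - n) * q)"

definition sylvester_matrix :: "nat \<Rightarrow> nat \<Rightarrow> 'a::comm_ring_1 poly \<Rightarrow> 'a poly \<Rightarrow> 'a mat" where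
  "sylvester_matrix m n p q = mat (n + m) (n + m) (\<lambda>(r, c). coeff (sylvester_row n p q r) c)"

abbreviation sylvester_det :: "nat \<Rightarrow> nat \<Rightarrow> 'a::comm_ring_1 poly \<Rightarrow> 'a poly \<Rightarrow> 'a" where
  "sylvester_det m n p q \<equiv> Determinant.det (sylvester_matrix m n p q)"

lemma sylvester_matrix_carrier [simp]: "sylvester_matrix m n p q \<in> carrier_mat (n + m) (n + m)"
  by (simp add: sylvester_matrix_def)

lemma degree_sylvester_row:
  assumes "degree p \<le> m" "degree q \<le> n" "r < n + m"
  shows "degree (sylvester_row n p q r) < n + m"
proof (cases "r < n")
  case True
  thus ?thesis
    using degree_mult_le[of "monom 1 r" p] degree_monom_le[of "1::'a" r] assms
    by (auto simp: sylvester_row_def)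
next
  case False
  thus ?thesis
    using degree_mult_le[of "monom 1 (r - n)" q] degree_monom_le[of "1::'a" "r - n"] assms
    by (auto simp: sylvester_row_def)
qed

lemma poly_eq_sum_lessThan:
  fixes p :: "'a::comm_ring_1 poly"
  shows "degree p < N \<Longrightarrow> poly p x = (\<Sum>c<N. coeff p c * x ^ c)"
  unfolding poly_altdef
  by (rule sum.mono_neutral_left) (auto simp: coeff_eq_0)

lemma pcompose_eq_sum_lessThan:
  fixes p L :: "'a::field_char_0 poly"
  assumes "degree p < N"
  shows "pcompose p L = (\<Sum>c<N. smult (coeff p c) (L ^ c))"
  by (subst poly_eq_poly_eq_iff[symmetric])
     (simp add: fun_eq_iff poly_pcompose poly_sum poly_eq_sum_lessThan[OF assms])

text \<open>
  The powers of a common root form a vector in the kernel of the Sylvester matrix.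
\<close>

lemma sylvester_det_eq_0:
  fixes p q :: "'a::field poly"
  assumes deg: "degree p \<le> m" "degree q \<le> n" and "0 < n + m"
    and root: "poly p x = 0" "poly q x = 0"
  shows "sylvester_det m n p q = 0"
proof -
  let ?v = "vec (n + m) (\<lambda>c. x ^ c)"
  have "sylvester_matrix m n p q *\<^sub>v ?v = 0\<^sub>v (n + m)"
  proof (rule eq_vecI)
    fix r assume r: "r < dim_vec (0\<^sub>v (n + m) :: 'a vec)"
    hence "vec_index (sylvester_matrix m n p q *\<^sub>v ?v) r =
          (\<Sum>c<n + m. coeff (sylvester_row n p q r) c * x ^ c)"
      by (simp add: sylvester_matrix_def scalar_prod_def atLeast0LessThan)
    also have "\<dots> = poly (sylvester_row n p q r) x"
      using poly_eq_sum_lessThan[OF degree_sylvester_row[OF deg]] r by simp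
    also have "\<dots> = 0" using root by (simp add: sylvester_row_def)
    finally show "vec_index (sylvester_matrix m n p q *\<^sub>v ?v) r = vec_index (0\<^sub>v (n + m)) r"
      using r by simp
  qed (simp add: sylvester_matrix_def)
  moreover have "?v \<noteq> 0\<^sub>v (n + m)"
  proof
    assume "?v = 0\<^sub>v (n + m)"
    hence "vec_index ?v 0 = vec_index (0\<^sub>v (n + m)) 0" by simp
    thus False using \<open>0 < n + m\<close> by simp
  qed
  ultimately show ?thesis
    using det_0_iff_vec_prod_zero_field[OF sylvester_matrix_carrier[of m n p q]]
    by (metis vec_carrier)
qed

text \<open>
  A linear dependency between the rows is an identity \<open>a p + b q = 0\<close> with \<open>b\<close>
  of degree less than \<open>m\<close>; but \<open>b\<close> vanishes at the \<open>m\<close> roots of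
  \<open>p\<close> in \<open>Z\<close>.
\<close>

lemma sylvester_det_neq_0:
  fixes p q :: "'a::field poly"
  assumes deg: "degree p \<le> m" "degree q \<le> n" and "p \<noteq> 0"
    and Z: "card Z = m" "\<And>x. x \<in> Z \<Longrightarrow> poly p x = 0 \<and> poly q x \<noteq> 0"
  shows "sylvester_det m n p q \<noteq> 0"
proof
  let ?S = "sylvester_matrix m n p q"
  let ?row = "sylvester_row n p q"
  assume "sylvester_det m n p q = 0"
  hence "Determinant.det (transpose_mat ?S) = 0"
    using det_transpose[of ?S "n + m"] by simp
  then obtain v where v: "v \<in> carrier_vec (n + m)" "v \<noteq> 0\<^sub>v (n + m)"
      "transpose_mat ?S *\<^sub>v v = 0\<^sub>v (n + m)"
    using det_0_iff_vec_prod_zero_field[of "transpose_mat ?S" "n + m"] by auto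
  define w where "w = vec_index v"
  define a where "a = (\<Sum>r<n. monom (w r) r)"
  define b where "b = (\<Sum>r<m. monom (w (n + r)) r)"
  have sum: "a * p + b * q = (\<Sum>r<n + m. smult (w r) (?row r))"
  proof -
    have "(\<Sum>r<n + m. smult (w r) (?row r)) =
          (\<Sum>r<n. smult (w r) (?row r)) + (\<Sum>r<m. smult (w (n + r)) (?row (n + r)))"
      by (induction m) (simp_all add: add.assoc)
    also have "(\<Sum>r<n. smult (w r) (?row r)) = a * p"
      by (simp add: a_def sum_distrib_right sylvester_row_def smult_monom mult_smult_left[symmetric] del: mult_smult_left)
    also have "(\<Sum>r<m. smult (w (n + r)) (?row (n + r))) = b * q"
      by (simp add: b_def sum_distrib_right sylvester_row_def smult_monom mult_smult_left[symmetric] del: mult_smult_left)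
    finally show ?thesis by simp
  qed
  have "a * p + b * q = 0"
  proof (rule poly_eqI)
    fix c
    show "coeff (a * p + b * q) c = coeff 0 c"
    proof (cases "c < n + m")
      case True
      have "vec_index (transpose_mat ?S *\<^sub>v v) c = (\<Sum>r<n + m. coeff (?row r) c * w r)"
        using True v(1)
        by (simp add: sylvester_matrix_def scalar_prod_def atLeast0LessThan w_def)
      hence "(\<Sum>r<n + m. coeff (?row r) c * w r) = 0" using v(3) True by simp
      thus ?thesis unfolding sum by (simp add: coeff_sum mult.commute)
    next
      case False
      hence "coeff (?row r) c = 0" if "r < n + m" for r
        using degree_sylvester_row[OF deg that] by (intro coeff_eq_0) linarith
      thus ?thesis unfolding sum by (simp add: coeff_sum)
    qed
  qed
  have coeff_a: "coeff a r = w r" if "r < n" for r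
    using that by (simp add: a_def coeff_sum)
  have coeff_b: "coeff b r = w (n + r)" if "r < m" for r
    using that by (simp add: b_def coeff_sum)
  have "b = 0"
  proof (rule ccontr)
    assume "b \<noteq> 0"
    have "poly b x = 0" if "x \<in> Z" for x
      using Z(2)[OF that] arg_cong[OF \<open>a * p + b * q = 0\<close>, of "\<lambda>f. poly f x"] by auto
    hence "Z \<subseteq> {x. poly b x = 0}" by auto
    hence "m \<le> degree b"
      using Z(1) card_mono[OF poly_roots_finite[OF \<open>b \<noteq> 0\<close>]] card_poly_roots_bound[OF \<open>b \<noteq> 0\<close>]
      by (metis le_trans)
    moreover have "coeff b r = 0" if "m \<le> r" for r
      using that by (simp add: b_def coeff_sum)
    ultimately show False using \<open>b \<noteq> 0\<close> leading_coeff_0_iff by blast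
  qed
  hence "a = 0" using \<open>a * p + b * q = 0\<close> \<open>p \<noteq> 0\<close> by simp
  have "w r = 0" if "r < n + m" for r
  proof (cases "r < n")
    case True
    thus ?thesis using coeff_a \<open>a = 0\<close> by (metis coeff_0)
  next
    case False
    thus ?thesis using coeff_b[of "r - n"] \<open>b = 0\<close> that by simp
  qed
  hence "v = 0\<^sub>v (n + m)" using v(1) by (intro eq_vecI) (auto simp: w_def)
  thus False using v(2) by simp
qed

lemma degree_linear_power: "degree ([:b, a:] ^ k) \<le> k"
  using degree_power_le[of "[:b, a:]" k] by (simp split: if_splits)

lemma lead_coeff_linear_power: "coeff ([:b, a:] ^ k) k = (a::'a::comm_ring_1) ^ k"
proof (induction k)
  case (Suc k)
  have "coeff ([:b, a:] ^ k) (Suc k) = 0"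
    using degree_linear_power[of b a k] by (intro coeff_eq_0) simp
  thus ?case using Suc by simp
qed simp

lemma det_lower_triangular_prod:
  fixes M :: "nat \<Rightarrow> nat \<Rightarrow> 'a::idom"
  assumes "\<And>i j. i < j \<Longrightarrow> j < N \<Longrightarrow> M i j = 0"
  shows "Determinant.det (mat N N (\<lambda>(i, j). M i j)) = (\<Prod>i<N. M i i)"
  by (subst det_lower_triangular[of N])
     (auto simp: assms prod_list_diag_prod atLeast0LessThan)

text \<open>
  Substituting \<open>L\<close> acts on the coefficient vectors of the rows by the lower triangular
  matrix of the powers of \<open>L\<close>. The rows for the substituted polynomials combine with the
  powers of \<open>L\<close> to the same vectors, again by a lower triangular matrix. Comparing
  determinants leaves \<open>\<Sum>k<n+m. k - \<Sum>k<n. k - \<Sum>k<m. k = m n\<close> factors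
  \<open>a\<close>.
\<close>

lemma sylvester_det_pcompose:
  fixes p q :: "'a::field_char_0 poly" and a b :: 'a
  defines "L \<equiv> [:b, a:]"
  assumes deg: "degree p \<le> m" "degree q \<le> n" and "a \<noteq> 0"
  shows "sylvester_det m n (pcompose p L) (pcompose q L) = a ^ (m * n) * sylvester_det m n p q"
proof -
  let ?N = "n + m"
  let ?row = "sylvester_row n p q" and ?row' = "sylvester_row n (pcompose p L) (pcompose q L)"
  let ?p = "\<lambda>k c. coeff (L ^ k) c"
  let ?d = "\<lambda>r k. if r < n then (if k < n then coeff (L ^ r) k else 0)
                  else (if k < n then 0 else coeff (L ^ (r - n)) (k - n))"
  let ?P = "mat ?N ?N (\<lambda>(k, c). ?p k c)" and ?D = "mat ?N ?N (\<lambda>(r, k). ?d r k)"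
  let ?S = "sylvester_matrix m n p q"
    and ?S' = "sylvester_matrix m n (pcompose p L) (pcompose q L)"
  have L0: "coeff (L ^ k) c = 0" if "k < c" for k c
    using degree_linear_power[of b a k] that by (intro coeff_eq_0) (simp add: L_def)
  have Lsum: "L ^ r = (\<Sum>k<l. monom (coeff (L ^ r) k) k)" if "r < l" for r l
  proof (rule poly_eqI)
    fix c show "coeff (L ^ r) c = coeff (\<Sum>k<l. monom (coeff (L ^ r) k) k) c"
      using that by (auto simp: coeff_sum L0)
  qed
  \<comment> \<open>row \<open>r\<close> of both products contains the coefficients of \<open>L\<^sup>r (p \<circ> L)\<close> or \<open>L\<^bsup>r - n\<^esup> (q \<circ> L)\<close>\<close>
  have SP: "?S * ?P = ?D * ?S'"
  proof (rule eq_matI)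
    fix r c assume "r < dim_row (?D * ?S')" "c < dim_col (?D * ?S')"
    hence rc: "r < ?N" "c < ?N" by (auto simp: sylvester_matrix_def)
    have "(?S * ?P) $$ (r, c) = (\<Sum>k<?N. coeff (?row r) k * coeff (L ^ k) c)"
      using rc by (simp add: sylvester_matrix_def scalar_prod_def atLeast0LessThan)
    also have "\<dots> = coeff (pcompose (?row r) L) c"
      by (subst pcompose_eq_sum_lessThan[OF degree_sylvester_row[OF deg rc(1)]])
         (simp add: coeff_sum)
    also have "pcompose (?row r) L = (if r < n then L ^ r * pcompose p L else L ^ (r - n) * pcompose q L)"
      by (subst poly_eq_poly_eq_iff[symmetric])
         (auto simp: fun_eq_iff poly_pcompose sylvester_row_def poly_monom)
    also have "coeff \<dots> c = (\<Sum>k<?N. ?d r k * coeff (?row' k) c)"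
    proof -
      have "(\<Sum>k<?N. ?d r k * coeff (?row' k) c) =
         (\<Sum>k<n. ?d r k * coeff (?row' k) c) + (\<Sum>k<m. ?d r (n + k) * coeff (?row' (n + k)) c)"
        by (induction m) (simp_all add: add.assoc)
      moreover have "(\<Sum>k<n. ?d r k * coeff (?row' k) c) =
           (if r < n then coeff (L ^ r * pcompose p L) c else 0)"
      proof (cases "r < n")
        case True
        have "coeff (L ^ r * pcompose p L) c =
              (\<Sum>k<n. coeff (monom (coeff (L ^ r) k) k * pcompose p L) c)"
          by (subst Lsum[OF True]) (simp add: sum_distrib_right coeff_sum)
        also have "\<dots> = (\<Sum>k<n. coeff (L ^ r) k * coeff (monom 1 k * pcompose p L) c)"
          by (rule sum.cong) (auto simp: coeff_monom_mult)
        finally show ?thesis using True by (simp add: sylvester_row_def)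
      qed simp
      moreover have "(\<Sum>k<m. ?d r (n + k) * coeff (?row' (n + k)) c) =
           (if r < n then 0 else coeff (L ^ (r - n) * pcompose q L) c)"
      proof (cases "r < n")
        case False
        hence "r - n < m" using rc by linarith
        have "coeff (L ^ (r - n) * pcompose q L) c =
              (\<Sum>k<m. coeff (monom (coeff (L ^ (r - n)) k) k * pcompose q L) c)"
          by (subst Lsum[OF \<open>r - n < m\<close>]) (simp add: sum_distrib_right coeff_sum)
        also have "\<dots> = (\<Sum>k<m. coeff (L ^ (r - n)) k * coeff (monom 1 k * pcompose q L) c)"
          by (rule sum.cong) (auto simp: coeff_monom_mult)
        finally show ?thesis using False by (simp add: sylvester_row_def)
      qed simp
      ultimately show ?thesis by auto
    qed
    also have "\<dots> = (?D * ?S') $$ (r, c)"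
      using rc by (simp add: sylvester_matrix_def scalar_prod_def atLeast0LessThan)
    finally show "(?S * ?P) $$ (r, c) = (?D * ?S') $$ (r, c)" .
  qed (auto simp: sylvester_matrix_def)
  have "Determinant.det (?S * ?P) = Determinant.det ?S * Determinant.det ?P"
    by (rule det_mult[where n = ?N]) simp_all
  moreover have "Determinant.det (?D * ?S') = Determinant.det ?D * Determinant.det ?S'"
    by (rule det_mult[where n = ?N]) simp_all
  ultimately have eq: "Determinant.det ?S * Determinant.det ?P = Determinant.det ?D * Determinant.det ?S'"
    unfolding SP by simp
  define K where "K = (\<Prod>k<n. a ^ k) * (\<Prod>k<m. a ^ k)"
  have "Determinant.det ?P = (\<Prod>k<?N. a ^ k)"
    by (subst det_lower_triangular_prod)
       (simp_all add: L0 lead_coeff_linear_power[of b a, folded L_def])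
  also have "\<dots> = K * a ^ (m * n)"
    unfolding K_def by (induction m) (simp_all add: power_add algebra_simps)
  finally have P: "Determinant.det ?P = K * a ^ (m * n)" .
  have "Determinant.det ?D = (\<Prod>k<?N. ?d k k)"
    by (subst det_lower_triangular_prod) (auto simp: L0)
  also have "\<dots> = (\<Prod>k<n. ?d k k) * (\<Prod>k<m. ?d (n + k) (n + k))"
    by (induction m) (simp_all add: mult.assoc)
  also have "\<dots> = K" by (simp add: K_def lead_coeff_linear_power[of b a, folded L_def])
  finally have D: "Determinant.det ?D = K" .
  have "K * Determinant.det ?S' = K * (a ^ (m * n) * Determinant.det ?S)"
    using eq unfolding P D by (simp only: mult_ac)
  moreover have "K \<noteq> 0" using \<open>a \<noteq> 0\<close> by (simp add: K_def)
  ultimately show ?thesis by simp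
qed

lemma sylvester_det_smult:
  fixes p q :: "'a::idom poly"
  shows "sylvester_det m n p (smult t q) = t ^ m * sylvester_det m n p q"
proof -
  let ?N = "n + m"
  let ?d = "\<lambda>i j. if i = j then if i < n then 1 else t else 0"
  let ?D = "mat ?N ?N (\<lambda>(i, j). ?d i j)"
  have "sylvester_matrix m n p (smult t q) = ?D * sylvester_matrix m n p q"
    by (rule eq_matI)
       (auto simp: sylvester_matrix_def scalar_prod_def sylvester_row_def if_distrib[of "\<lambda>x. x * _"]
          sum.delta' cong: if_cong)
  moreover have "Determinant.det ?D = (\<Prod>k<?N. ?d k k)"
    by (subst det_lower_triangular_prod) auto
  moreover have "(\<Prod>k<?N. ?d k k) = t ^ m"
    by (induction m) simp_all
  ultimately show ?thesis
    using det_mult[of ?D ?N "sylvester_matrix m n p q"] by simp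
qed

section \<open>Determinants over an algebra of functions\<close>

text \<open>
  A Sylvester determinant whose entries are polynomial in some parameters is polynomial in them, and one
  whose entries are continuous is continuous. Both are instances of one closure argument.
\<close>

locale function_algebra =
  fixes A :: "('t \<Rightarrow> 'a::comm_ring_1) set"
  assumes const: "(\<lambda>_. c) \<in> A"
    and add: "f \<in> A \<Longrightarrow> g \<in> A \<Longrightarrow> (\<lambda>t. f t + g t) \<in> A"
    and mult: "f \<in> A \<Longrightarrow> g \<in> A \<Longrightarrow> (\<lambda>t. f t * g t) \<in> A"
begin

lemma sum: "(\<And>k. k \<in> I \<Longrightarrow> f k \<in> A) \<Longrightarrow> (\<lambda>t. \<Sum>k\<in>I. f k t) \<in> A"
  by (induction I rule: infinite_finite_induct) (auto intro: const add)

lemma prod: "(\<And>k. k \<in> I \<Longrightarrow> f k \<in> A) \<Longrightarrow> (\<lambda>t. \<Prod>k\<in>I. f k t) \<in> A"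
  by (induction I rule: infinite_finite_induct) (auto intro: const mult)

lemma det:
  assumes "\<And>r c. (\<lambda>t. M t r c) \<in> A"
  shows "(\<lambda>t. Determinant.det (mat N N (\<lambda>(r, c). M t r c))) \<in> A"
proof -
  have "Determinant.det (mat N N (\<lambda>(r, c). M t r c)) =
      (\<Sum>\<pi> | \<pi> permutes {0..<N}. signof \<pi> * (\<Prod>i = 0..<N. M t i (\<pi> i)))" for t
    by (subst det_def'[of _ N]) (auto intro!: sum.cong prod.cong simp: permutes_in_image[of _ "{0..<N}"])
  thus ?thesis by (simp add: sum mult const prod assms)
qed

definition coeffs_in :: "('t \<Rightarrow> 'a poly) \<Rightarrow> bool" where
  "coeffs_in P \<longleftrightarrow> (\<forall>k. (\<lambda>t. coeff (P t) k) \<in> A)"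

lemma coeffs_in_add: "coeffs_in P \<Longrightarrow> coeffs_in Q \<Longrightarrow> coeffs_in (\<lambda>t. P t + Q t)"
  by (simp add: coeffs_in_def add)

lemma coeffs_in_mult: "coeffs_in P \<Longrightarrow> coeffs_in Q \<Longrightarrow> coeffs_in (\<lambda>t. P t * Q t)"
  by (simp add: coeffs_in_def coeff_mult sum mult)

lemma coeffs_in_const: "coeffs_in (\<lambda>_. p)"
  by (simp add: coeffs_in_def const)

lemma coeffs_in_smult: "f \<in> A \<Longrightarrow> coeffs_in P \<Longrightarrow> coeffs_in (\<lambda>t. smult (f t) (P t))"
  by (simp add: coeffs_in_def mult)

lemma coeffs_in_linear: "f \<in> A \<Longrightarrow> g \<in> A \<Longrightarrow> coeffs_in (\<lambda>t. [:f t, g t:])"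
  unfolding coeffs_in_def
proof
  fix k assume "f \<in> A" "g \<in> A"
  consider "k = 0" | "k = 1" | l where "k = Suc (Suc l)" by (metis One_nat_def nat.exhaust)
  thus "(\<lambda>t. coeff [:f t, g t:] k) \<in> A"
    by cases (simp_all add: \<open>f \<in> A\<close> \<open>g \<in> A\<close> const)
qed

lemma coeffs_in_power: "coeffs_in P \<Longrightarrow> coeffs_in (\<lambda>t. P t ^ k)"
  by (induction k) (simp_all add: coeffs_in_const coeffs_in_mult)

lemma coeffs_in_sum: "(\<And>k. k \<in> I \<Longrightarrow> coeffs_in (P k)) \<Longrightarrow> coeffs_in (\<lambda>t. \<Sum>k\<in>I. P k t)"
  by (simp add: coeffs_in_def coeff_sum sum)

lemma coeffs_in_pcompose: "coeffs_in P \<Longrightarrow> coeffs_in (\<lambda>t. pcompose q (P t))"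
  by (induction q) (simp_all add: pcompose_pCons coeffs_in_const coeffs_in_mult coeffs_in_add)

lemma coeffs_in_compose2:
  "coeffs_in X \<Longrightarrow> coeffs_in Y \<Longrightarrow> coeffs_in (\<lambda>t. compose2 f (X t) (Y t))"
  unfolding compose2_def
  by (intro coeffs_in_sum coeffs_in_mult coeffs_in_pcompose coeffs_in_power)

lemma sylvester_det:
  assumes "coeffs_in P" "coeffs_in Q"
  shows "(\<lambda>t. sylvester_det m n (P t) (Q t)) \<in> A"
proof -
  have "(\<lambda>t. coeff (sylvester_row n (P t) (Q t) r) c) \<in> A" for r c
    using assms coeffs_in_mult[OF coeffs_in_const[of "monom 1 r"] assms(1)]
      coeffs_in_mult[OF coeffs_in_const[of "monom 1 (r - n)"] assms(2)]
    by (cases "r < n") (simp_all add: sylvester_row_def coeffs_in_def)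
  thus ?thesis unfolding sylvester_matrix_def by (rule det)
qed

end

section \<open>The equation of the curve of normals\<close>

text \<open>
  Along the line \<open>t \<mapsto> (1, v) / t\<close>, the polynomial \<open>R\<close> is a polynomial
  in \<open>1 / t\<close> whose coefficient of \<open>t\<^bsup>-k\<^esup>\<close> is the value at
  \<open>(1, v)\<close> of the homogeneous part of degree \<open>k\<close>. If the growth at \<open>t =
  0\<close> is of order at most \<open>n\<close> for all \<open>v\<close>, then the parts of higher
  degree vanish on a line that misses the origin, so they are zero.
\<close>

lemma total_degree_le_from_growth:
  fixes R :: "complex poly poly"
  assumes "\<And>v. \<exists>l. ((\<lambda>t. t ^ n * eval2 R (1 / t, v / t)) \<longlongrightarrow> l) (at 0)"
  shows "total_degree_le n R"
  unfolding total_degree_le_def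
proof (intro allI impI, rule ccontr)
  fix i j assume nz: "coeff (coeff R j) i \<noteq> 0" and "\<not> i + j \<le> n"
  define k where "k = i + j"
  have "k > n" using \<open>\<not> i + j \<le> n\<close> by (simp add: k_def)
  have deg: "degree (compose2 R [:0, 1:] [:0, v:]) \<le> n" for v
  proof (rule ccontr)
    let ?P = "compose2 R [:0, 1:] [:0, v:]"
    let ?m = "degree ?P"
    assume "\<not> ?m \<le> n"
    obtain l where l: "((\<lambda>t. t ^ n * eval2 R (1 / t, v / t)) \<longlongrightarrow> l) (at 0)"
      using assms by blast
    have "((\<lambda>t. t ^ (?m - n) * (t ^ n * eval2 R (1 / t, v / t))) \<longlongrightarrow> 0 ^ (?m - n) * l) (at 0)"
      by (intro tendsto_intros l)
    moreover have "\<forall>\<^sub>F t in at 0. t ^ (?m - n) * (t ^ n * eval2 R (1 / t, v / t)) = poly (reflect_poly ?P) t"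
    proof (rule eventually_mono)
      show "\<forall>\<^sub>F t in at (0::complex). t \<noteq> 0" by (simp add: eventually_at_filter)
      fix t :: complex assume "t \<noteq> 0"
      have "t ^ (?m - n) * (t ^ n * eval2 R (1 / t, v / t)) = t ^ ?m * eval2 R (1 / t, v / t)"
        using \<open>\<not> ?m \<le> n\<close> by (simp add: mult.assoc[symmetric] power_add[symmetric])
      thus "t ^ (?m - n) * (t ^ n * eval2 R (1 / t, v / t)) = poly (reflect_poly ?P) t"
        using \<open>t \<noteq> 0\<close> by (simp add: poly_reflect_poly_nz poly_compose2 field_simps)
    qed
    ultimately have "((\<lambda>t. poly (reflect_poly ?P) t) \<longlongrightarrow> 0 ^ (?m - n) * l) (at 0)"
      using tendsto_cong by fast
    moreover have "((\<lambda>t. poly (reflect_poly ?P) t) \<longlongrightarrow> poly (reflect_poly ?P) 0) (at 0)"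
      by (intro isContD poly_isCont)
    ultimately have "poly (reflect_poly ?P) 0 = 0 ^ (?m - n) * l"
      using LIM_unique by blast
    hence "lead_coeff ?P = 0" using \<open>\<not> ?m \<le> n\<close> by simp
    thus False using \<open>\<not> ?m \<le> n\<close> by (metis degree_0 leading_coeff_0_iff zero_le)
  qed
  define W where "W = (\<Sum>j\<le>degree R. monom (if j \<le> k then coeff (coeff R j) (k - j) else 0) j)"
  have "poly W v = coeff (compose2 R [:0, 1:] [:0, v:]) k" for v
  proof -
    have "[:0, v:] ^ j = monom (v ^ j) j" for j
      by (metis monom_0 monom_Suc monom_power mult_1 One_nat_def)
    thus ?thesis
      by (simp add: W_def compose2_def coeff_sum poly_sum poly_monom pcompose_idR
          mult.commute[of _ "monom _ _"] coeff_monom_mult)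
         (intro sum.cong, auto)
  qed
  hence "poly W v = 0" for v using deg[of v] \<open>k > n\<close> by (simp add: coeff_eq_0)
  hence "W = 0" using poly_all_0_iff_0 by blast
  moreover have "j \<le> degree R" using nz by (metis coeff_0 le_degree)
  hence "coeff W j = coeff (coeff R j) i" by (simp add: W_def coeff_sum k_def)
  ultimately show False using nz by simp
qed

interpretation poly_functions:
  function_algebra "{h. \<exists>R. \<forall>p. h p = eval2 R (p :: complex \<times> complex)}"
proof
  show "(\<lambda>_. c) \<in> {h. \<exists>R. \<forall>p. h p = eval2 R p}" for c :: complex
    by (auto intro!: exI[of _ "[:[:c:]:]"])
qed (auto simp flip: eval2_add eval2_mult)

interpretation cont_functions: function_algebra "{h :: complex \<Rightarrow> complex. isCont h 0}"
  by standard auto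

text \<open>
  The determinant \<open>R\<close> vanishes on normals because the restrictions of \<open>F\<close> and
  of \<open>F\<^sub>y + u F\<^sub>x\<close> to a normal have a common zero at its foot, and it is
  nonzero at \<open>(0, 0)\<close> because \<open>F\<close> has \<open>d\<close> zeros on the line
  \<open>y = 0\<close> and \<open>F\<^sub>y\<close> vanishes at none of them. The degree of the entries
  only gives a bound near \<open>2 d\<^sup>2\<close> for the total degree: the parametrisation of a line
  by \<open>x\<close> degenerates when the line becomes vertical. Near infinity the line \<open>(u, v) =
  (1, v) / t\<close> is therefore parametrised by \<open>y\<close>, through \<open>x = - v - t
  y\<close>. This substitution contributes the factor \<open>(- t)\<^bsup>d (d - 1)\<^esup>\<close>, and
  in the new coordinate only the \<open>d\<close> rows of \<open>F\<^sub>y + u F\<^sub>x\<close> grow,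
  each like \<open>1 / t\<close>. So \<open>t\<^bsup>d\<^sup>2\<^esup> R\<close> stays bounded.
\<close>

theorem normal_polynomial_exists:
  fixes F :: "complex poly poly"
  assumes F: "total_degree_le d F" and "d > 0"
    and Z: "card Z = d" "\<And>x. x \<in> Z \<Longrightarrow> eval2 F (x, 0) = 0 \<and> eval2 (partial_y F) (x, 0) \<noteq> 0"
    and nz: "eval2 F (x0, 0) \<noteq> 0"
  obtains R where "R \<noteq> 0" "total_degree_le (d\<^sup>2) R"
    and "\<And>u v x y. y = - u * x - v \<Longrightarrow> eval2 F (x, y) = 0 \<Longrightarrow>
           eval2 (partial_y F) (x, y) + u * eval2 (partial_x F) (x, y) = 0 \<Longrightarrow> eval2 R (u, v) = 0"
proof -
  define \<phi> where "\<phi> = (\<lambda>X Y. compose2 F X Y)"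
  define \<psi> where "\<psi> = (\<lambda>a b X Y. smult a (compose2 (partial_y F) X Y) + smult b (compose2 (partial_x F) X Y))"
  have deg\<phi>: "degree (\<phi> X Y) \<le> d" if "degree X \<le> 1" "degree Y \<le> 1" for X Y
    unfolding \<phi>_def by (rule degree_compose2_le[OF F that])
  have deg\<psi>: "degree (\<psi> a b X Y) \<le> d - 1" if "degree X \<le> 1" "degree Y \<le> 1" for a b X Y
    unfolding \<psi>_def
    by (intro degree_add_le order.trans[OF degree_smult_le] degree_compose2_le
        total_degree_le_partial_x total_degree_le_partial_y F that)
  let ?D = "sylvester_det d (d - 1)"
  define h where "h = (\<lambda>p. ?D (\<phi> [:0, 1:] [:- snd p, - fst p:]) (\<psi> 1 (fst p) [:0, 1:] [:- snd p, - fst p:]))"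
  have "h \<in> {h. \<exists>R. \<forall>p. h p = eval2 R p}"
  proof -
    have "\<exists>R. \<forall>p. - fst p = eval2 R (p :: complex \<times> complex)" "\<exists>R. \<forall>p. - snd p = eval2 R (p :: complex \<times> complex)"
      "\<exists>R. \<forall>p. fst p = eval2 R (p :: complex \<times> complex)"
      by (auto simp: eval2_def intro: exI[of _ "[:[:0, -1:]:]"] exI[of _ "[:0, -1:]"] exI[of _ "[:[:0, 1:]:]"])
    thus ?thesis
      unfolding h_def \<phi>_def \<psi>_def
      by (intro poly_functions.sylvester_det poly_functions.coeffs_in_compose2
           poly_functions.coeffs_in_add poly_functions.coeffs_in_smult
           poly_functions.coeffs_in_linear poly_functions.coeffs_in_const poly_functions.const) simp_all
  qed
  then obtain R where R: "\<And>p. h p = eval2 R p" by auto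
  show ?thesis
  proof
    have "h (0, 0) \<noteq> 0"
      unfolding h_def
    proof (rule sylvester_det_neq_0)
      show "\<phi> [:0, 1:] [:- snd (0, 0), - fst (0, 0):] \<noteq> 0"
        using nz poly_compose2[of F "[:0, 1:]" "[:0, 0:]" x0] by (auto simp: \<phi>_def)
      fix x assume "x \<in> Z"
      thus "poly (\<phi> [:0, 1:] [:- snd (0, 0), - fst (0, 0):]) x = 0 \<and>
            poly (\<psi> 1 (fst (0, 0)) [:0, 1:] [:- snd (0, 0), - fst (0, 0):]) x \<noteq> 0"
        using Z(2) by (simp add: \<phi>_def \<psi>_def poly_compose2)
    qed (use deg\<phi>[of "[:0, 1:]" 0] deg\<psi>[of "[:0, 1:]" 0 1 0] Z(1) in simp_all)
    thus "R \<noteq> 0" using R[of "(0, 0)"] by auto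
    show "total_degree_le (d\<^sup>2) R"
    proof (rule total_degree_le_from_growth)
      fix v :: complex
      let ?X = "\<lambda>t. [:- v, - t:] :: complex poly"
      let ?g = "\<lambda>t. ?D (\<phi> (?X t) [:0, 1:]) (\<psi> t 1 (?X t) [:0, 1:])"
      have "?g \<in> {h. isCont h 0}"
        unfolding \<phi>_def \<psi>_def
        by (intro cont_functions.sylvester_det cont_functions.coeffs_in_compose2
           cont_functions.coeffs_in_add cont_functions.coeffs_in_smult
           cont_functions.coeffs_in_linear cont_functions.coeffs_in_const cont_functions.const) simp_all
      hence "(?g \<longlongrightarrow> ?g 0) (at 0)" by (simp add: isCont_def)
      hence lim: "((\<lambda>t. (-1) ^ (d * (d - 1)) * ?g t) \<longlongrightarrow> (-1) ^ (d * (d - 1)) * ?g 0) (at 0)"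
        by (intro tendsto_intros)
      have "t ^ (d\<^sup>2) * eval2 R (1 / t, v / t) = (-1) ^ (d * (d - 1)) * ?g t" if "t \<noteq> 0" for t
      proof -
        let ?Y = "[:- (v / t), - (1 / t):]"
        have X: "pcompose [:0, 1:] (?X t) = ?X t" by (simp add: pcompose_pCons)
        have Y: "pcompose ?Y (?X t) = [:0, 1:]" using that by (simp add: pcompose_pCons)
        have c\<phi>: "pcompose (\<phi> [:0, 1:] ?Y) (?X t) = \<phi> (?X t) [:0, 1:]"
          unfolding \<phi>_def pcompose_compose2 X Y ..
        have c\<psi>: "pcompose (\<psi> t 1 [:0, 1:] ?Y) (?X t) = \<psi> t 1 (?X t) [:0, 1:]"
          unfolding \<psi>_def pcompose_add pcompose_smult pcompose_compose2 X Y ..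
        have "?g t = (- t) ^ (d * (d - 1)) * ?D (\<phi> [:0, 1:] ?Y) (\<psi> t 1 [:0, 1:] ?Y)"
          unfolding c\<phi>[symmetric] c\<psi>[symmetric] using that
          by (intro sylvester_det_pcompose deg\<phi> deg\<psi>) auto
        moreover have "\<psi> t 1 [:0, 1:] ?Y = smult t (\<psi> 1 (1 / t) [:0, 1:] ?Y)"
          using that by (simp add: \<psi>_def smult_add_right)
        moreover have "?D P (smult t Q) = t ^ d * ?D P Q" for P Q
          by (rule sylvester_det_smult)
        ultimately have g: "?g t = (- t) ^ (d * (d - 1)) * t ^ d * h (1 / t, v / t)"
          by (simp add: h_def)
        have "(-1) ^ (d * (d - 1)) * (- t) ^ (d * (d - 1)) = t ^ (d * (d - 1))"
          unfolding power_mult_distrib[symmetric] by simp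
        moreover have "d * (d - 1) + d = d\<^sup>2" using \<open>d > 0\<close> by (simp add: power2_eq_square algebra_simps)
        ultimately have "(-1) ^ (d * (d - 1)) * ?g t = t ^ (d\<^sup>2) * h (1 / t, v / t)"
          unfolding g mult.assoc[symmetric] by (simp only: power_add[symmetric])
        thus ?thesis by (simp only: R)
      qed
      hence "\<forall>\<^sub>F t in at 0. (-1) ^ (d * (d - 1)) * ?g t = t ^ (d\<^sup>2) * eval2 R (1 / t, v / t)"
        by (simp add: eventually_at_filter)
      thus "\<exists>l. ((\<lambda>t. t ^ (d\<^sup>2) * eval2 R (1 / t, v / t)) \<longlongrightarrow> l) (at 0)"
        using lim tendsto_cong by fast
    qed
    fix u v x y
    assume y: "y = - u * x - v" and F0: "eval2 F (x, y) = 0"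
      and N0: "eval2 (partial_y F) (x, y) + u * eval2 (partial_x F) (x, y) = 0"
    have y': "- v - x * u = y" by (simp add: y mult.commute)
    have "h (u, v) = 0"
      unfolding h_def using \<open>d > 0\<close>
      by (intro sylvester_det_eq_0[where x = x] deg\<phi> deg\<psi>)
         (simp_all add: \<phi>_def \<psi>_def poly_compose2 y' F0 N0)
    thus "eval2 R (u, v) = 0" by (simp add: R)
  qed
qed


section \<open>Zeros that survive perturbation\<close>

text \<open>
  The map \<open>(t, q) \<mapsto> (t, \<Phi> t q)\<close> has a surjective derivative at
  \<open>(t\<^sub>0, q\<^sub>0)\<close>, so it is open there: all \<open>(t, 0)\<close> with
  \<open>t\<close> near \<open>t\<^sub>0\<close> are values in \<open>W\<close>. The set
  \<open>W\<close> carries the open conditions that the persisting zero should satisfy.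
\<close>

lemma stable_zero:
  fixes \<Phi> :: "'t::euclidean_space \<Rightarrow> 'q::euclidean_space \<Rightarrow> 'q"
  assumes cont: "continuous_on UNIV (\<lambda>z. \<Phi> (fst z) (snd z))"
    and diff: "(\<lambda>z. \<Phi> (fst z) (snd z)) differentiable at (t0, q0)"
    and zero: "\<Phi> t0 q0 = 0"
    and deriv: "(\<Phi> t0 has_derivative D) (at q0)" and inj: "\<And>q. D q = 0 \<Longrightarrow> q = 0"
    and W: "open W" "(t0, q0) \<in> W"
  shows "\<forall>\<^sub>F t in nhds t0. \<exists>q. (t, q) \<in> W \<and> \<Phi> t q = 0"
proof -
  obtain \<Phi>' where \<Phi>': "((\<lambda>z. \<Phi> (fst z) (snd z)) has_derivative \<Phi>') (at (t0, q0))"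
    using diff by (auto simp: differentiable_def)
  interpret \<Phi>': bounded_linear \<Phi>' using \<Phi>' by (rule has_derivative_bounded_linear)
  have linD: "linear D" using deriv has_derivative_bounded_linear bounded_linear.linear by blast
  have D: "\<Phi>' (0, dq) = D dq" for dq
  proof -
    have "((\<lambda>q. (t0, q)) has_derivative (\<lambda>dq. (0, dq))) (at q0)"
      by (auto intro!: derivative_eq_intros)
    hence "((\<lambda>q. \<Phi> t0 q) has_derivative (\<lambda>dq. \<Phi>' (0, dq))) (at q0)"
      using has_derivative_compose[of "\<lambda>q. (t0, q)" _ q0 UNIV "\<lambda>z. \<Phi> (fst z) (snd z)" \<Phi>'] \<Phi>'
      by simp
    thus ?thesis using has_derivative_unique[OF deriv] by metis
  qed
  have "inj D" using linD inj by (simp add: linear_injective_0)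
  hence "surj D" using linD linear_injective_imp_surjective by blast
  then obtain G where G: "linear G" "D \<circ> G = id"
    using linear_surjective_right_inverse[OF linD] by blast
  define f where "f = (\<lambda>z. (fst z, \<Phi> (fst z) (snd z)))"
  define f' where "f' = (\<lambda>z. (fst z, \<Phi>' z))"
  define g' where "g' = (\<lambda>z. (fst z, G (snd z - \<Phi>' (fst z, 0))))"
  have "(t0, 0) \<in> interior (f ` W)"
  proof -
    have "f (t0, q0) \<in> interior (f ` W)"
    proof (rule sussmann_open_mapping[where S = UNIV and f' = f' and g' = g'])
      show "continuous_on UNIV f" unfolding f_def by (intro continuous_intros cont)
      show "(f has_derivative f') (at (t0, q0))"
        unfolding f_def f'_def by (intro derivative_intros \<Phi>')
      have "linear g'"
        unfolding g'_def
        by (rule linearI)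
           (simp_all add: linear_add[OF G(1)] linear_diff[OF G(1)] linear_scale[OF G(1)]
              \<Phi>'.add[of "(_, 0)" "(_, 0)", simplified] \<Phi>'.scaleR[of _ "(_, 0)", simplified] algebra_simps)
      thus "bounded_linear g'" by (simp add: linear_conv_bounded_linear)
      have "\<Phi>' (a, G (b - \<Phi>' (a, 0))) = b" for a b
      proof -
        have "\<Phi>' (a, G (b - \<Phi>' (a, 0))) = \<Phi>' (a, 0) + \<Phi>' (0, G (b - \<Phi>' (a, 0)))"
          using \<Phi>'.add[of "(a, 0)" "(0, G (b - \<Phi>' (a, 0)))"] by simp
        also have "\<dots> = b" using fun_cong[OF G(2)] by (simp add: D)
        finally show ?thesis .
      qed
      thus "f' \<circ> g' = id" by (auto simp: f'_def g'_def)
    qed (use W interior_open[of W] in auto)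
    thus ?thesis by (simp add: f_def zero)
  qed
  then obtain r where "r > 0" and r: "ball (t0, 0) r \<subseteq> f ` W"
    by (meson mem_interior)
  have "\<forall>\<^sub>F t in nhds t0. dist t t0 < r"
    using \<open>r > 0\<close> by (auto simp: eventually_nhds_metric)
  thus ?thesis
  proof eventually_elim
    case (elim t)
    hence "(t, 0) \<in> ball (t0, 0) r" by (simp add: dist_Pair_Pair dist_commute)
    hence "(t, 0) \<in> f ` W" using r by blast
    thus ?case by (auto simp: f_def)
  qed
qed

lemma continuous_on_eval2 [continuous_intros]:
  fixes F :: "real poly poly"
  assumes "continuous_on S a" "continuous_on S b"
  shows "continuous_on S (\<lambda>z. eval2 F (a z, b z))"
  unfolding eval2_altdef poly_altdef by (intro continuous_intros | simp add: assms)+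

lemma differentiable_eval2:
  fixes F :: "real poly poly"
  assumes "a differentiable at z" "b differentiable at z"
  shows "(\<lambda>z. eval2 F (a z, b z)) differentiable at z"
  unfolding eval2_altdef poly_altdef
  by (simp, intro differentiable_sum finite_atMost ballI differentiable_mult differentiable_power
      differentiable_const assms)

section \<open>Perturbing an arrangement of lines\<close>

text \<open>
  The derivative of \<open>f\<close> along \<open>(u, 1)\<close>. This vector is perpendicular to the lines of slope \<open>- u\<close>,
  so the line through \<open>p\<close> of slope \<open>- u\<close> is normal to \<open>f = 0\<close> when this derivative vanishes at \<open>p\<close>.
\<close>

definition normal_deriv :: "'a::idom \<Rightarrow> 'a poly poly \<Rightarrow> 'a \<times> 'a \<Rightarrow> 'a" where
  "normal_deriv u f p = eval2 (partial_y f) p + u * eval2 (partial_x f) p"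

lemma normal_deriv_add: "normal_deriv u (f + g) p = normal_deriv u f p + normal_deriv u g p"
  by (simp add: normal_deriv_def partial_x_add partial_y_add algebra_simps)

lemma normal_deriv_mult:
  "normal_deriv u (f * g) p = eval2 f p * normal_deriv u g p + normal_deriv u f p * eval2 g p"
  by (simp add: normal_deriv_def partial_x_mult partial_y_mult algebra_simps)

lemma normal_deriv_smult [simp]: "normal_deriv u (smult [:c:] f) p = c * normal_deriv u f p"
  by (simp add: normal_deriv_def algebra_simps)

definition line :: "real \<Rightarrow> real poly poly" where
  "line b = [:[:- inverse b, b:], 1:]"

lemma eval2_line: "eval2 (line b) (x, y) = y + b * x - inverse b"
  by (simp add: line_def eval2_def)

lemma partial_line [simp]: "partial_x (line b) = [:[:b:]:]" "partial_y (line b) = [:[:1:]:]"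
  by (simp_all add: line_def partial_x_def partial_y_def map_poly_pCons pderiv_pCons one_pCons)

lemma normal_deriv_line [simp]: "normal_deriv u (line b) p = 1 + u * b"
  by (simp add: normal_deriv_def)

lemma total_degree_le_line: "total_degree_le 1 (line b)"
  by (auto simp: total_degree_le_def line_def coeff_pCons one_pCons split: nat.splits if_splits)

text \<open>
  Written as \<open>\<beta>\<^sup>2 x + \<beta> y = 1\<close>, the lines correspond to the points
  \<open>(\<beta>, \<beta>\<^sup>2)\<close> of a parabola, and \<open>\<beta>\<^sub>i +
  \<beta>\<^sub>j\<close> is the slope of the chord through two of these points. Distinct chords must
  have distinct slopes.
\<close>

locale line_arrangement =
  fixes d :: nat and \<beta> :: "nat \<Rightarrow> real"
  assumes pos [simp]: "0 < \<beta> k"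
    and inj: "inj_on \<beta> {..<d}"
    and sidon: "\<lbrakk>i < d; j < d; i \<noteq> j; k < d; l < d; k \<noteq> l; \<beta> i + \<beta> j = \<beta> k + \<beta> l\<rbrakk> \<Longrightarrow> {i, j} = {k, l}"
begin

lemma beta_neq_0 [simp]: "\<beta> k \<noteq> 0" using pos[of k] by (metis less_irrefl)

lemma \<beta>_eq_iff: "i < d \<Longrightarrow> j < d \<Longrightarrow> \<beta> i = \<beta> j \<longleftrightarrow> i = j"
  using inj by (auto simp: inj_on_def)

definition lines :: "nat set \<Rightarrow> real poly poly" where
  "lines A = (\<Prod>k\<in>A. line (\<beta> k))"

text \<open>
  Any positive weights would smooth the nodes to the right side; these make the limit system at a node
  solvable without square roots.
\<close>

definition weight :: "nat \<Rightarrow> nat \<Rightarrow> real" where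
  "weight i j = (1 + \<beta> i * (\<beta> i + \<beta> j)) * (1 + \<beta> j * (\<beta> i + \<beta> j))"

text \<open>The sum runs over ordered pairs, so each node is counted twice, with half its weight.\<close>

definition bump :: "real poly poly" where
  "bump = (\<Sum>(i, j)\<in>{(i, j). i < d \<and> j < d \<and> i \<noteq> j}. smult [:weight i j / 2:] (lines ({..<d} - {i, j})))"

definition curve :: "real \<Rightarrow> real poly poly" where
  "curve \<delta> = lines {..<d} + smult [:\<delta>\<^sup>2:] bump"

lemma total_degree_le_lines: "total_degree_le (card A) (lines A)"
  unfolding lines_def by (intro total_degree_le_prod total_degree_le_line)

lemma total_degree_le_curve: "total_degree_le d (curve \<delta>)"
proof -
  have "total_degree_le d (lines ({..<d} - A))" for A
    using total_degree_le_mono[OF total_degree_le_lines] card_mono[of "{..<d}" "{..<d} - A"] by simp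
  hence "total_degree_le d bump"
    unfolding bump_def by (intro total_degree_le_sum) (auto intro: total_degree_le_smult)
  thus ?thesis
    unfolding curve_def using total_degree_le_lines[of "{..<d}"]
    by (intro total_degree_le_add total_degree_le_smult) auto
qed

lemma lines_remove: "k < d \<Longrightarrow> k \<in> A \<Longrightarrow> finite A \<Longrightarrow> lines A = line (\<beta> k) * lines (A - {k})"
  unfolding lines_def by (rule prod.remove) auto

lemma eval2_lines_nz:
  "finite A \<Longrightarrow> (\<And>k. k \<in> A \<Longrightarrow> eval2 (line (\<beta> k)) p \<noteq> 0) \<Longrightarrow> eval2 (lines A) p \<noteq> 0"
  by (simp add: lines_def)

abbreviation curve_x where "curve_x \<delta> \<equiv> partial_x (curve \<delta>)"
abbreviation curve_y where "curve_y \<delta> \<equiv> partial_y (curve \<delta>)"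

text \<open>
  The line of slope \<open>- u\<close> through \<open>(0, s)\<close> is normal to the curve at its point
  with abscissa \<open>x\<close>. The last condition says that this point is nonsingular.
\<close>

definition normal_foot :: "real \<Rightarrow> real \<Rightarrow> real \<Rightarrow> real \<Rightarrow> bool" where
  "normal_foot \<delta> s u x \<longleftrightarrow> eval2 (curve \<delta>) (x, s - u * x) = 0 \<and>
     normal_deriv u (curve \<delta>) (x, s - u * x) = 0 \<and> eval2 (curve_x \<delta>) (x, s - u * x) \<noteq> 0"

subsection \<open>Points on a single line\<close>

lemma eval2_curve: "eval2 (curve \<delta>) p = eval2 (curve 0) p + \<delta>\<^sup>2 * eval2 bump p"
  and eval2_curve_x: "eval2 (curve_x \<delta>) p = eval2 (curve_x 0) p + \<delta>\<^sup>2 * eval2 (partial_x bump) p"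
  and eval2_curve_y: "eval2 (curve_y \<delta>) p = eval2 (curve_y 0) p + \<delta>\<^sup>2 * eval2 (partial_y bump) p"
  by (simp_all add: curve_def partial_x_add partial_y_add)

lemma curve_0_split:
  assumes "i < d"
  shows "curve 0 = line (\<beta> i) * lines ({..<d} - {i})"
  using assms by (simp add: curve_def lines_remove)

text \<open>
  A transversal crossing of one of the lines with the line through \<open>(a, b)\<close> in direction
  \<open>(w\<^sub>1, w\<^sub>2)\<close> persists when the arrangement is perturbed (parameter
  \<open>\<delta>\<close>, first component of \<open>t\<close>) and the second line is translated along
  \<open>(v\<^sub>1, v\<^sub>2)\<close> (parameter \<open>\<sigma>\<close>, second component).
\<close>

lemma crossing_persists:
  assumes i: "i < d" and on: "eval2 (line (\<beta> i)) (a, b) = 0"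
    and off: "\<And>k. k < d \<Longrightarrow> k \<noteq> i \<Longrightarrow> eval2 (line (\<beta> k)) (a, b) \<noteq> 0"
    and trans: "w2 + \<beta> i * w1 \<noteq> 0" and "e > 0"
  shows "\<forall>\<^sub>F t in nhds (0, 0). \<exists>q. \<bar>q\<bar> < e \<and>
      eval2 (curve (fst t)) (a + snd t * v1 + q * w1, b + snd t * v2 + q * w2) = 0 \<and>
      eval2 (curve_x (fst t)) (a + snd t * v1 + q * w1, b + snd t * v2 + q * w2) \<noteq> 0 \<and>
      eval2 (curve_y (fst t)) (a + snd t * v1 + q * w1, b + snd t * v2 + q * w2) \<noteq> 0"
proof -
  let ?M = "lines ({..<d} - {i})"
  define P where "P = (\<lambda>(t :: real \<times> real) (q :: real). (a + snd t * v1 + q * w1, b + snd t * v2 + q * w2 :: real))"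
  define \<Phi> where "\<Phi> = (\<lambda>t q. eval2 (curve (fst t)) (P t q))"
  define W where "W = {(t, q). \<bar>q\<bar> < e \<and> eval2 (curve_x (fst t)) (P t q) \<noteq> 0 \<and> eval2 (curve_y (fst t)) (P t q) \<noteq> 0}"
  have M: "eval2 ?M (a, b) \<noteq> 0" using off by (intro eval2_lines_nz) auto
  have "\<forall>\<^sub>F t in nhds (0, 0). \<exists>q. (t, q) \<in> W \<and> \<Phi> t q = 0"
  proof (rule stable_zero[where D = "\<lambda>dq. eval2 ?M (a, b) * (w2 + \<beta> i * w1) * dq" and ?q0.0 = 0])
    show "continuous_on UNIV (\<lambda>z. \<Phi> (fst z) (snd z))"
      unfolding \<Phi>_def P_def eval2_curve[of "fst (fst _)"] by (intro continuous_intros)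
    show "(\<lambda>z. \<Phi> (fst z) (snd z)) differentiable at ((0, 0), 0)"
      unfolding \<Phi>_def P_def eval2_curve[of "fst (fst _)"]
      by (intro differentiable_add differentiable_mult differentiable_power differentiable_eval2
          differentiable_const bounded_linear_imp_differentiable bounded_linear_fst bounded_linear_snd
          bounded_linear_compose[OF bounded_linear_fst] bounded_linear_compose[OF bounded_linear_snd])
    show "\<Phi> (0, 0) 0 = 0" by (simp add: \<Phi>_def P_def curve_0_split[OF i] on)
    have "(\<lambda>q. eval2 ?M (a + q * w1, b + q * w2)) differentiable at 0"
      by (intro differentiable_eval2 differentiable_add differentiable_mult differentiable_const differentiable_ident)
    then obtain M' where M': "((\<lambda>q. eval2 ?M (a + q * w1, b + q * w2)) has_derivative M') (at 0)"
      by (auto simp: differentiable_def)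
    have l: "((\<lambda>q. eval2 (line (\<beta> i)) (a + q * w1, b + q * w2)) has_derivative
        (\<lambda>dq. (w2 + \<beta> i * w1) * dq)) (at 0)"
      unfolding eval2_line by (auto intro!: derivative_eq_intros simp: algebra_simps)
    have "((\<lambda>q. eval2 (line (\<beta> i)) (a + q * w1, b + q * w2) * eval2 ?M (a + q * w1, b + q * w2))
           has_derivative (\<lambda>dq. eval2 ?M (a, b) * (w2 + \<beta> i * w1) * dq)) (at 0)"
      using has_derivative_mult[OF l M'] by (simp add: on mult_ac)
    thus "(\<Phi> (0, 0) has_derivative (\<lambda>dq. eval2 ?M (a, b) * (w2 + \<beta> i * w1) * dq)) (at 0)"
      by (simp add: \<Phi>_def P_def curve_0_split[OF i])
    show "dq = 0" if "eval2 ?M (a, b) * (w2 + \<beta> i * w1) * dq = 0" for dq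
      using that M trans by simp
    show "open W"
      unfolding W_def P_def case_prod_unfold eval2_curve_x[of "fst (fst _)"] eval2_curve_y[of "fst (fst _)"]
      by (intro open_Collect_conj open_Collect_less open_Collect_neq continuous_intros)
    show "((0, 0), 0) \<in> W"
      using M \<open>e > 0\<close>
      by (simp add: W_def P_def curve_0_split[OF i] partial_x_mult partial_y_mult on)
  qed
  thus ?thesis by (rule eventually_mono) (auto simp: W_def \<Phi>_def P_def)
qed

text \<open>
  The foot of the perpendicular from the origin to a line of the arrangement lies on no other line, and
  slope and abscissa \<open>(u, x)\<close> are a nondegenerate zero of the equations for normals. The
  translation of the origin is scaled as \<open>s = \<delta> \<sigma>\<close> to match the scaling
  needed at the nodes.
\<close>

lemma foot_persists:
  assumes i: "i < d" and "e > 0"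
  shows "\<forall>\<^sub>F t in nhds (0, 0). \<exists>u x. \<bar>u - (- inverse (\<beta> i))\<bar> < e \<and> normal_foot (fst t) (fst t * snd t) u x"
proof -
  let ?M = "lines ({..<d} - {i})"
  define u0 x0 where "u0 = - inverse (\<beta> i)" and "x0 = inverse (1 + (\<beta> i)\<^sup>2)"
  define P where "P = (\<lambda>(t :: real \<times> real) q. (snd q, fst t * snd t - fst q * snd q :: real))"
  define \<Phi> where "\<Phi> = (\<lambda>t q. (eval2 (curve (fst t)) (P t q), normal_deriv (fst q) (curve (fst t)) (P t q)))"
  define W where "W = {(t, q). \<bar>fst q - u0\<bar> < e \<and> eval2 (curve_x (fst t)) (P t q) \<noteq> 0}"
  have x0: "x0 * (1 + (\<beta> i)\<^sup>2) = 1" "x0 > 0"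
  proof -
    have "0 < 1 + (\<beta> i)\<^sup>2" by (simp add: add_pos_nonneg)
    thus "x0 * (1 + (\<beta> i)\<^sup>2) = 1" "x0 > 0" by (simp_all add: x0_def)
  qed
  have on: "eval2 (line (\<beta> i)) (x0, - u0 * x0) = 0"
    using x0(1) by (simp add: eval2_line u0_def field_simps power2_eq_square)
  have M: "eval2 ?M (x0, - u0 * x0) \<noteq> 0"
  proof (rule eval2_lines_nz)
    fix k assume k: "k \<in> {..<d} - {i}"
    have "eval2 (line (\<beta> k)) (x0, - u0 * x0) * (\<beta> i * \<beta> k * (1 + (\<beta> i)\<^sup>2)) =
        (x0 * (1 + (\<beta> i)\<^sup>2)) * (\<beta> k + \<beta> i * \<beta> k * \<beta> k) - \<beta> i * (1 + (\<beta> i)\<^sup>2)"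
      by (simp add: eval2_line u0_def field_simps power2_eq_square)
    also have "\<dots> = (\<beta> k - \<beta> i) * (1 + \<beta> i * (\<beta> k + \<beta> i))"
      unfolding x0(1) by (simp add: algebra_simps power2_eq_square)
    also have "\<dots> \<noteq> 0"
    proof -
      have "1 + \<beta> i * (\<beta> k + \<beta> i) > 0" by (intro add_pos_nonneg) (simp_all add: less_imp_le)
      thus ?thesis using k i \<beta>_eq_iff[of k i] by auto
    qed
    finally show "eval2 (line (\<beta> k)) (x0, - u0 * x0) \<noteq> 0" by auto
  qed simp
  define K where "K = eval2 ?M (x0, - u0 * x0)"
  define N where "N = normal_deriv u0 ?M (x0, - u0 * x0)"
  define dl where "dl = (\<lambda>dq :: real \<times> real. - x0 * fst dq - (u0 - \<beta> i) * snd dq)"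
  have "\<forall>\<^sub>F t in nhds (0, 0). \<exists>q. (t, q) \<in> W \<and> \<Phi> t q = 0"
  proof (rule stable_zero[where D = "\<lambda>dq. (dl dq * K, dl dq * N + \<beta> i * fst dq * K)" and ?q0.0 = "(u0, x0)"])
    show "continuous_on UNIV (\<lambda>z. \<Phi> (fst z) (snd z))"
      unfolding \<Phi>_def P_def normal_deriv_def eval2_curve[of "fst (fst _)"]
         eval2_curve_x[of "fst (fst _)"] eval2_curve_y[of "fst (fst _)"] by (intro continuous_intros)
    show "(\<lambda>z. \<Phi> (fst z) (snd z)) differentiable at ((0, 0), (u0, x0))"
      unfolding \<Phi>_def P_def normal_deriv_def eval2_curve[of "fst (fst _)"]
         eval2_curve_x[of "fst (fst _)"] eval2_curve_y[of "fst (fst _)"]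
      by (intro differentiable_Pair differentiable_add differentiable_diff differentiable_mult
          differentiable_power differentiable_eval2
          differentiable_const bounded_linear_imp_differentiable bounded_linear_fst bounded_linear_snd
          bounded_linear_compose[OF bounded_linear_fst] bounded_linear_compose[OF bounded_linear_snd])
    show "\<Phi> (0, 0) (u0, x0) = 0"
      using on by (simp add: \<Phi>_def P_def curve_0_split[OF i] normal_deriv_mult u0_def zero_prod_def)
    have "(\<lambda>q. eval2 ?M (snd q, - fst q * snd q)) differentiable at (u0, x0)"
         "(\<lambda>q. normal_deriv (fst q) ?M (snd q, - fst q * snd q)) differentiable at (u0, x0)"
      unfolding normal_deriv_def
      by (intro differentiable_eval2 differentiable_add differentiable_mult differentiable_minus
         bounded_linear_imp_differentiable bounded_linear_fst bounded_linear_snd)+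
    then obtain M' N' where
      "((\<lambda>q. eval2 ?M (snd q, - fst q * snd q)) has_derivative M') (at (u0, x0))"
      "((\<lambda>q. normal_deriv (fst q) ?M (snd q, - fst q * snd q)) has_derivative N') (at (u0, x0))"
      by (auto simp: differentiable_def)
    note M'N' = this
    have l: "((\<lambda>q. eval2 (line (\<beta> i)) (snd q, - fst q * snd q)) has_derivative dl) (at (u0, x0))"
      unfolding eval2_line dl_def by (auto intro!: derivative_eq_intros simp: algebra_simps)
    have "((\<lambda>q. (eval2 (line (\<beta> i)) (snd q, - fst q * snd q) * eval2 ?M (snd q, - fst q * snd q),
           eval2 (line (\<beta> i)) (snd q, - fst q * snd q) * normal_deriv (fst q) ?M (snd q, - fst q * snd q) +
           (1 + fst q * \<beta> i) * eval2 ?M (snd q, - fst q * snd q)))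
         has_derivative (\<lambda>dq. (dl dq * K, dl dq * N + \<beta> i * fst dq * K))) (at (u0, x0))"
      by (rule derivative_eq_intros l M'N' refl)+
         (use on in \<open>auto simp: K_def N_def u0_def fun_eq_iff algebra_simps\<close>)
    thus "(\<Phi> (0, 0) has_derivative (\<lambda>dq. (dl dq * K, dl dq * N + \<beta> i * fst dq * K))) (at (u0, x0))"
      by (simp add: \<Phi>_def P_def curve_0_split[OF i] normal_deriv_mult)
    show "dq = 0" if "(dl dq * K, dl dq * N + \<beta> i * fst dq * K) = 0" for dq
    proof -
      have "dl dq = 0" "fst dq = 0" using that M by (auto simp: zero_prod_def K_def)
      moreover have "u0 - \<beta> i < 0" 
        unfolding u0_def using pos[of i] positive_imp_inverse_positive[OF pos[of i]] by linarith
      ultimately show ?thesis by (auto simp: dl_def prod_eq_iff)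
    qed
    show "open W"
      unfolding W_def P_def case_prod_unfold eval2_curve_x[of "fst (fst _)"]
      by (intro open_Collect_conj open_Collect_less open_Collect_neq continuous_intros)
    show "((0, 0), (u0, x0)) \<in> W"
      using M \<open>e > 0\<close> on
      by (simp add: W_def P_def curve_0_split[OF i] partial_x_mult)
  qed
  thus ?thesis
  proof (rule eventually_mono)
    fix t assume "\<exists>q. (t, q) \<in> W \<and> \<Phi> t q = 0"
    then obtain q where "(t, q) \<in> W" "\<Phi> t q = 0" by blast
    hence "\<bar>fst q - (- inverse (\<beta> i))\<bar> < e \<and> normal_foot (fst t) (fst t * snd t) (fst q) (snd q)"
      by (simp add: W_def \<Phi>_def P_def normal_foot_def u0_def zero_prod_def)
    thus "\<exists>u x. \<bar>u - (- inverse (\<beta> i))\<bar> < e \<and> normal_foot (fst t) (fst t * snd t) u x" by blast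
  qed
qed

subsection \<open>Nodes\<close>

lemma eval2_bump_node:
  assumes ij: "i < d" "j < d" "i \<noteq> j"
    and p: "eval2 (line (\<beta> i)) p = 0" "eval2 (line (\<beta> j)) p = 0"
  shows "eval2 bump p = weight i j * eval2 (lines ({..<d} - {i, j})) p"
proof -
  let ?I = "{(i, j). i < d \<and> j < d \<and> i \<noteq> j}"
  let ?f = "\<lambda>(a, b). weight a b / 2 * eval2 (lines ({..<d} - {a, b})) p"
  have "eval2 bump p = (\<Sum>ab\<in>?I. ?f ab)"
    unfolding bump_def eval2_sum by (rule sum.cong) auto
  also have "\<dots> = (\<Sum>ab\<in>{(i, j), (j, i)}. ?f ab)"
  proof (rule sum.mono_neutral_right)
    show "finite ?I" by (rule finite_subset[of _ "{..<d} \<times> {..<d}"]) auto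
    show "{(i, j), (j, i)} \<subseteq> ?I" using ij by auto
    show "\<forall>ab\<in>?I - {(i, j), (j, i)}. ?f ab = 0"
    proof
      fix ab assume ab: "ab \<in> ?I - {(i, j), (j, i)}"
      obtain a b where [simp]: "ab = (a, b)" by (cases ab)
      have "i \<in> {..<d} - {a, b} \<or> j \<in> {..<d} - {a, b}" using ab ij by auto
      hence "eval2 (lines ({..<d} - {a, b})) p = 0"
        using p by (auto simp: lines_def)
      thus "?f ab = 0" by simp
    qed
  qed
  also have "\<dots> = weight i j * eval2 (lines ({..<d} - {i, j})) p"
    using ij by (simp add: weight_def insert_commute algebra_simps)
  finally show ?thesis .
qed

text \<open>
  With \<open>u = u\<^sub>0 + \<delta> U\<close>, \<open>x = x\<^sub>0 + \<delta> X\<close> and \<open>s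
  = \<delta> \<sigma>\<close>, where \<open>u\<^sub>0\<close> and \<open>x\<^sub>0\<close> belong to the
  node, the equations of the two lines through the node become \<open>\<delta> A\<^sub>i\<close> and
  \<open>\<delta> A\<^sub>j\<close>. After division by \<open>\<delta>\<^sup>2\<close> and
  \<open>\<delta>\<close>, the equations for normals have for \<open>\<delta> = 0\<close> the limits
  \<open>A\<^sub>i A\<^sub>j + w\<^sub>i\<^sub>j = 0\<close> and \<open>e\<^sub>i A\<^sub>j + e\<^sub>j
  A\<^sub>i = 0\<close>, up to the factor \<open>K\<close> from the other lines, with \<open>e\<^sub>k =
  1 + u\<^sub>0 \<beta>\<^sub>k\<close>. Since \<open>w\<^sub>i\<^sub>j = e\<^sub>i e\<^sub>j\<close>, a
  solution is \<open>A\<^sub>i = e\<^sub>i\<close>, \<open>A\<^sub>j = - e\<^sub>j\<close>. Exchanging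
  \<open>i\<close> and \<open>j\<close> gives the other solution, on the opposite branch of the
  hyperbola; the values of \<open>u\<close> for the two normals lie on different sides of
  \<open>u\<^sub>0\<close>, and the sign in the conclusion tells them apart.
\<close>

lemma node_persists:
  assumes i: "i < d" and j: "j < d" and ij: "i \<noteq> j" and "e > 0"
  shows "\<forall>\<^sub>F t in nhds (0, 0). 0 < fst t \<longrightarrow> (\<exists>u x. \<bar>u - (\<beta> i + \<beta> j)\<bar> < e \<and>
      0 < (u - (\<beta> i + \<beta> j)) * (\<beta> i - \<beta> j) \<and> normal_foot (fst t) (fst t * snd t) u x)"
proof -
  let ?M = "lines ({..<d} - {i, j})"
  define u0 x0 where "u0 = \<beta> i + \<beta> j" and "x0 = - inverse (\<beta> i * \<beta> j)"
  define ei ej where "ei = 1 + u0 * \<beta> i" and "ej = 1 + u0 * \<beta> j"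
  have e_pos: "ei > 0" "ej > 0"
    by (simp_all add: ei_def ej_def u0_def add_pos_pos)
  have \<beta>_neq: "\<beta> i - \<beta> j \<noteq> 0" using \<beta>_eq_iff i j ij by simp
  have x0: "x0 * \<beta> i = - inverse (\<beta> j)" "x0 * \<beta> j = - inverse (\<beta> i)" "x0 \<noteq> 0"
    by (simp_all add: x0_def)
  \<comment> \<open>the solution of \<open>A\<^sub>i = e\<^sub>i\<close>, \<open>A\<^sub>j = - e\<^sub>j\<close>, a linear system in \<open>(U, X)\<close> for \<open>\<delta> = \<sigma> = 0\<close>\<close>
  define X0 where "X0 = (ei + ej) / (\<beta> i - \<beta> j)"
  define U0 where "U0 = \<beta> i * \<beta> j * (\<beta> j * ej + \<beta> i * ei) / (\<beta> i - \<beta> j)"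
  define u where "u = (\<lambda>(t :: real \<times> real) q :: real \<times> real. u0 + fst t * fst q)"
  define x where "x = (\<lambda>(t :: real \<times> real) q :: real \<times> real. x0 + fst t * snd q)"
  define P where "P = (\<lambda>t q. (x t q, fst t * snd t - u t q * x t q))"
  define A where "A = (\<lambda>b (t :: real \<times> real) q :: real \<times> real. snd t - b * snd q - x0 * fst q - fst t * fst q * snd q)"
  define Ai Aj where "Ai = A (\<beta> j)" and "Aj = A (\<beta> i)"
  define \<Phi>1 where "\<Phi>1 = (\<lambda>t q. Ai t q * Aj t q * eval2 ?M (P t q) + eval2 bump (P t q))"
  define \<Phi>2 where "\<Phi>2 = (\<lambda>t q. ((1 + u t q * \<beta> i) * Aj t q + (1 + u t q * \<beta> j) * Ai t q) * eval2 ?M (P t q)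
      + fst t * (Ai t q * Aj t q * normal_deriv (u t q) ?M (P t q) + normal_deriv (u t q) bump (P t q)))"
  define \<Phi>3 where "\<Phi>3 = (\<lambda>t q. (\<beta> i * Aj t q + \<beta> j * Ai t q) * eval2 ?M (P t q)
      + fst t * (Ai t q * Aj t q * eval2 (partial_x ?M) (P t q) + eval2 (partial_x bump) (P t q)))"
  have curve_split: "curve \<delta> = line (\<beta> i) * (line (\<beta> j) * ?M) + smult [:\<delta>\<^sup>2:] bump" for \<delta>
  proof -
    have "lines {..<d} = line (\<beta> i) * lines ({..<d} - {i})" using i by (intro lines_remove) auto
    also have "lines ({..<d} - {i}) = line (\<beta> j) * lines ({..<d} - {i} - {j})"
      using j ij by (intro lines_remove) auto
    also have "{..<d} - {i} - {j} = {..<d} - {i, j}" by auto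
    finally show ?thesis by (simp add: curve_def)
  qed
  have li: "eval2 (line (\<beta> i)) (P t q) = fst t * Ai t q" for t q
  proof -
    have "eval2 (line (\<beta> i)) (P t q) = fst t * Ai t q - x0 * \<beta> j - inverse (\<beta> i)"
      by (simp add: eval2_line P_def x_def u_def Ai_def A_def u0_def algebra_simps)
    thus ?thesis by (simp add: x0)
  qed
  have lj: "eval2 (line (\<beta> j)) (P t q) = fst t * Aj t q" for t q
  proof -
    have "eval2 (line (\<beta> j)) (P t q) = fst t * Aj t q - x0 * \<beta> i - inverse (\<beta> j)"
      by (simp add: eval2_line P_def x_def u_def Aj_def A_def u0_def algebra_simps)
    thus ?thesis by (simp add: x0)
  qed
  have F1: "eval2 (curve (fst t)) (P t q) = (fst t)\<^sup>2 * \<Phi>1 t q" for t q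
    by (simp add: curve_split li lj \<Phi>1_def algebra_simps power2_eq_square)
  have F2: "normal_deriv (u t q) (curve (fst t)) (P t q) = fst t * \<Phi>2 t q" for t q
    by (simp add: curve_split normal_deriv_add normal_deriv_mult li lj \<Phi>2_def algebra_simps power2_eq_square)
  have F3: "eval2 (curve_x (fst t)) (P t q) = fst t * \<Phi>3 t q" for t q
    by (simp add: curve_split partial_x_add partial_x_mult li lj \<Phi>3_def algebra_simps power2_eq_square)
  define p0 where "p0 = (x0, - u0 * x0)"
  have P0: "P (0, 0) q = p0" for q by (simp add: P_def p0_def x_def u_def)
  have p0: "eval2 (line (\<beta> i)) p0 = 0" "eval2 (line (\<beta> j)) p0 = 0"
    using li[of "(0, 0)" 0] lj[of "(0, 0)" 0] by (simp_all add: P0)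
  define K where "K = eval2 ?M p0"
  have "K \<noteq> 0"
    unfolding K_def
  proof (rule eval2_lines_nz)
    fix k assume k: "k \<in> {..<d} - {i, j}"
    have "eval2 (line (\<beta> k)) p0 * (\<beta> i * \<beta> j * \<beta> k) = - (\<beta> k - \<beta> i) * (\<beta> k - \<beta> j)"
      by (simp add: eval2_line p0_def x0_def u0_def field_simps)
    moreover have "- (\<beta> k - \<beta> i) * (\<beta> k - \<beta> j) \<noteq> 0" using k i j \<beta>_eq_iff by auto
    ultimately show "eval2 (line (\<beta> k)) p0 \<noteq> 0" by auto
  qed simp
  have bump0: "eval2 bump p0 = ei * ej * K"
    using eval2_bump_node[OF i j ij p0] by (simp add: weight_def K_def ei_def ej_def u0_def mult.commute)
  have A0: "A b (0, 0) q = - b * snd q - x0 * fst q" for b q by (simp add: A_def)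
  have X0: "X0 * (\<beta> i - \<beta> j) = ei + ej" using \<beta>_neq by (simp add: X0_def)
  have U0: "x0 * U0 * (\<beta> i - \<beta> j) = - (\<beta> j * ej + \<beta> i * ei)"
  proof -
    have "x0 * (\<beta> i * \<beta> j) = - 1" by (simp add: x0_def field_simps)
    moreover have "x0 * U0 * (\<beta> i - \<beta> j) = x0 * (\<beta> i * \<beta> j) * (\<beta> j * ej + \<beta> i * ei)"
      using \<beta>_neq by (simp add: U0_def)
    ultimately show ?thesis by simp
  qed
  have base: "Ai (0, 0) (U0, X0) = ei" "Aj (0, 0) (U0, X0) = - ej"
  proof -
    have "(- b * X0 - x0 * U0) * (\<beta> i - \<beta> j) = - b * (ei + ej) + (\<beta> j * ej + \<beta> i * ei)" for b
    proof -
      have "(- b * X0 - x0 * U0) * (\<beta> i - \<beta> j) = - b * (X0 * (\<beta> i - \<beta> j)) - x0 * U0 * (\<beta> i - \<beta> j)"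
        by (simp only: left_diff_distrib mult.assoc)
      thus ?thesis unfolding X0 U0 by simp
    qed
    note * = this
    have "(- \<beta> j * X0 - x0 * U0) * (\<beta> i - \<beta> j) = ei * (\<beta> i - \<beta> j)"
         "(- \<beta> i * X0 - x0 * U0) * (\<beta> i - \<beta> j) = (- ej) * (\<beta> i - \<beta> j)"
      unfolding * by (simp_all add: algebra_simps)
    thus "Ai (0, 0) (U0, X0) = ei" "Aj (0, 0) (U0, X0) = - ej"
      unfolding Ai_def Aj_def A0 fst_conv snd_conv using \<beta>_neq mult_right_cancel by blast+
  qed
  define W where "W = {(t, q). \<bar>fst t * fst q\<bar> < e \<and> 0 < fst q * (\<beta> i - \<beta> j) \<and> \<Phi>3 t q \<noteq> 0}"
  define D where "D = (\<lambda>dq :: real \<times> real.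
     let da = - \<beta> j * snd dq - x0 * fst dq; db = - \<beta> i * snd dq - x0 * fst dq
     in ((ei * db - ej * da) * K, (ei * db + ej * da) * K))"
  have "\<forall>\<^sub>F t in nhds (0, 0). \<exists>q. (t, q) \<in> W \<and> (\<Phi>1 t q, \<Phi>2 t q) = 0"
  proof (rule stable_zero[where D = D and ?q0.0 = "(U0, X0)"])
    show "continuous_on UNIV (\<lambda>z. (\<Phi>1 (fst z) (snd z), \<Phi>2 (fst z) (snd z)))"
      unfolding \<Phi>1_def \<Phi>2_def P_def normal_deriv_def u_def x_def Ai_def Aj_def A_def
      by (intro continuous_intros)
    show "(\<lambda>z. (\<Phi>1 (fst z) (snd z), \<Phi>2 (fst z) (snd z))) differentiable at ((0, 0), (U0, X0))"
      unfolding \<Phi>1_def \<Phi>2_def P_def normal_deriv_def u_def x_def Ai_def Aj_def A_def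
      by (intro differentiable_Pair differentiable_add differentiable_diff differentiable_mult
          differentiable_power differentiable_eval2
          differentiable_const bounded_linear_imp_differentiable bounded_linear_fst bounded_linear_snd
          bounded_linear_compose[OF bounded_linear_fst] bounded_linear_compose[OF bounded_linear_snd])
    show "(\<Phi>1 (0, 0) (U0, X0), \<Phi>2 (0, 0) (U0, X0)) = 0"
      by (simp add: \<Phi>1_def \<Phi>2_def base P0 bump0 u_def zero_prod_def K_def[symmetric]
          ei_def[symmetric] ej_def[symmetric])
    define la lb where "la = (\<lambda>q :: real \<times> real. - \<beta> j * snd q - x0 * fst q)"
      and "lb = (\<lambda>q :: real \<times> real. - \<beta> i * snd q - x0 * fst q)"
    have la: "(la has_derivative la) (at z)" and lb: "(lb has_derivative lb) (at z)" for z
      unfolding la_def lb_def by (auto intro!: derivative_eq_intros)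
    have lab: "la (U0, X0) = ei" "lb (U0, X0) = - ej"
      using base unfolding Ai_def Aj_def A0 la_def lb_def by simp_all
    have D_eq: "D = (\<lambda>dq. ((ei * lb dq - ej * la dq) * K, (ei * lb dq + ej * la dq) * K))"
      by (simp add: D_def Let_def la_def lb_def)
    have "((\<lambda>q. (la q * lb q * K + ei * ej * K, (ei * lb q + ej * la q) * K)) has_derivative D) (at (U0, X0))"
      unfolding D_eq
      by (rule derivative_eq_intros la lb refl)+ (simp add: fun_eq_iff lab algebra_simps)
    thus "((\<lambda>q. (\<Phi>1 (0, 0) q, \<Phi>2 (0, 0) q)) has_derivative D) (at (U0, X0))"
      by (simp add: \<Phi>1_def \<Phi>2_def P0 bump0 u_def Ai_def Aj_def A0 la_def lb_def K_def[symmetric]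
          ei_def[symmetric] ej_def[symmetric])
    show "dq = 0" if "D dq = 0" for dq
    proof -
      define da db where "da = - \<beta> j * snd dq - x0 * fst dq" and "db = - \<beta> i * snd dq - x0 * fst dq"
      have "ei * db - ej * da = 0" "ei * db + ej * da = 0"
        using that \<open>K \<noteq> 0\<close> by (auto simp: D_def Let_def zero_prod_def da_def db_def)
      hence "ei * db = 0" "ej * da = 0" by linarith+
      hence "da = 0" "db = 0" using e_pos by auto
      moreover have "da - db = (\<beta> i - \<beta> j) * snd dq" by (simp add: da_def db_def algebra_simps)
      ultimately have "snd dq = 0" using \<beta>_neq by auto
      thus ?thesis using \<open>da = 0\<close> x0 by (auto simp: da_def prod_eq_iff)
    qed
    show "open W"
      unfolding W_def \<Phi>3_def P_def u_def x_def Ai_def Aj_def A_def case_prod_unfold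
      by (intro open_Collect_conj open_Collect_less open_Collect_neq continuous_intros)
    have "\<beta> j * ei - \<beta> i * ej = \<beta> j - \<beta> i" by (simp add: ei_def ej_def algebra_simps)
    hence "\<Phi>3 (0, 0) (U0, X0) \<noteq> 0"
      using \<beta>_neq \<open>K \<noteq> 0\<close> by (simp add: \<Phi>3_def base P0 K_def[symmetric])
    moreover have "0 < U0 * (\<beta> i - \<beta> j)"
      using \<beta>_neq e_pos by (simp add: U0_def add_pos_pos)
    ultimately show "((0, 0), (U0, X0)) \<in> W" using \<open>e > 0\<close> by (simp add: W_def)
  qed
  thus ?thesis
  proof (rule eventually_mono, intro impI)
    fix t :: "real \<times> real"
    assume "\<exists>q. (t, q) \<in> W \<and> (\<Phi>1 t q, \<Phi>2 t q) = 0" and t: "0 < fst t"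
    then obtain q where q: "(t, q) \<in> W" "\<Phi>1 t q = 0" "\<Phi>2 t q = 0" by (auto simp: zero_prod_def)
    have "normal_foot (fst t) (fst t * snd t) (u t q) (x t q)"
      using q t F1[of t q] F2[of t q] F3[of t q] by (auto simp: normal_foot_def W_def P_def)
    moreover have "\<bar>u t q - (\<beta> i + \<beta> j)\<bar> < e" using q(1) by (simp add: W_def u_def u0_def)
    moreover have "0 < (u t q - (\<beta> i + \<beta> j)) * (\<beta> i - \<beta> j)"
      using q(1) t by (simp add: W_def u_def u0_def mult.assoc)
    ultimately show "\<exists>u x. \<bar>u - (\<beta> i + \<beta> j)\<bar> < e \<and>
      0 < (u - (\<beta> i + \<beta> j)) * (\<beta> i - \<beta> j) \<and> normal_foot (fst t) (fst t * snd t) u x" by blast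
  qed
qed

subsection \<open>All real normals at once\<close>

lemma separation:
  fixes V :: "real set"
  assumes "finite V"
  shows "\<exists>e>0. \<forall>x\<in>V. \<forall>y\<in>V. x \<noteq> y \<longrightarrow> 2 * e \<le> \<bar>x - y\<bar>"
proof -
  define G where "G = insert 1 ((\<lambda>(x, y). \<bar>x - y\<bar>) ` {(x, y) \<in> V \<times> V. x \<noteq> y})"
  have "finite G" unfolding G_def using assms by (auto intro: finite_subset[of _ "V \<times> V"])
  moreover have "\<forall>g\<in>G. g > 0" "G \<noteq> {}" by (auto simp: G_def)
  ultimately have "Min G > 0" by simp
  moreover have "Min G \<le> \<bar>x - y\<bar>" if "x \<in> V" "y \<in> V" "x \<noteq> y" for x y
    using \<open>finite G\<close> that by (intro Min_le) (auto simp: G_def)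
  ultimately show ?thesis by (intro exI[of _ "Min G / 2"]) auto
qed

lemma line_crossings:
  assumes on: "\<And>i. i < d \<Longrightarrow> eval2 (line (\<beta> i)) (a + c i * w1, b + c i * w2) = 0"
    and trans: "\<And>i. i < d \<Longrightarrow> w2 + \<beta> i * w1 \<noteq> 0" and c: "inj_on c {..<d}"
  shows "\<forall>\<^sub>F t in nhds (0, 0). \<exists>Q. finite Q \<and> card Q = d \<and> (\<forall>q\<in>Q.
      eval2 (curve (fst t)) (a + snd t * v1 + q * w1, b + snd t * v2 + q * w2) = 0 \<and>
      eval2 (curve_x (fst t)) (a + snd t * v1 + q * w1, b + snd t * v2 + q * w2) \<noteq> 0 \<and>
      eval2 (curve_y (fst t)) (a + snd t * v1 + q * w1, b + snd t * v2 + q * w2) \<noteq> 0)"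
proof -
  define P where "P = (\<lambda>(t :: real \<times> real) q. eval2 (curve (fst t)) (a + snd t * v1 + q * w1, b + snd t * v2 + q * w2) = 0 \<and>
      eval2 (curve_x (fst t)) (a + snd t * v1 + q * w1, b + snd t * v2 + q * w2) \<noteq> 0 \<and>
      eval2 (curve_y (fst t)) (a + snd t * v1 + q * w1, b + snd t * v2 + q * w2) \<noteq> 0)"
  obtain e where "e > 0" and e: "\<And>x y. x \<in> c ` {..<d} \<Longrightarrow> y \<in> c ` {..<d} \<Longrightarrow> x \<noteq> y \<Longrightarrow> 2 * e \<le> \<bar>x - y\<bar>"
    using separation[of "c ` {..<d}"] by auto
  have "\<forall>\<^sub>F t in nhds (0, 0). \<forall>i\<in>{..<d}. \<exists>q. \<bar>q - c i\<bar> < e \<and> P t q"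
  proof (intro eventually_ball_finite ballI)
    fix i assume "i \<in> {..<d}"
    hence i: "i < d" by simp
    have off: "eval2 (line (\<beta> k)) (a + c i * w1, b + c i * w2) \<noteq> 0" if "k < d" "k \<noteq> i" for k
    proof -
      have "eval2 (line (\<beta> k)) (a + c i * w1, b + c i * w2) =
            eval2 (line (\<beta> k)) (a + c k * w1, b + c k * w2) + (c i - c k) * (w2 + \<beta> k * w1)"
        by (simp add: eval2_line algebra_simps)
      thus ?thesis using on[OF that(1)] trans[OF that(1)] c that i by (auto simp: inj_on_def)
    qed
    show "\<forall>\<^sub>F t in nhds (0, 0). \<exists>q. \<bar>q - c i\<bar> < e \<and> P t q"
    proof (rule eventually_mono[OF crossing_persists[OF i on[OF i] off trans[OF i] \<open>e > 0\<close>, of v1 v2]])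
      fix t :: "real \<times> real"
      assume "\<exists>q. \<bar>q\<bar> < e \<and>
        eval2 (curve (fst t)) (a + c i * w1 + snd t * v1 + q * w1, b + c i * w2 + snd t * v2 + q * w2) = 0 \<and>
        eval2 (curve_x (fst t)) (a + c i * w1 + snd t * v1 + q * w1, b + c i * w2 + snd t * v2 + q * w2) \<noteq> 0 \<and>
        eval2 (curve_y (fst t)) (a + c i * w1 + snd t * v1 + q * w1, b + c i * w2 + snd t * v2 + q * w2) \<noteq> 0"
      then obtain q where q: "\<bar>q\<bar> < e"
        "eval2 (curve (fst t)) (a + c i * w1 + snd t * v1 + q * w1, b + c i * w2 + snd t * v2 + q * w2) = 0"
        "eval2 (curve_x (fst t)) (a + c i * w1 + snd t * v1 + q * w1, b + c i * w2 + snd t * v2 + q * w2) \<noteq> 0"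
        "eval2 (curve_y (fst t)) (a + c i * w1 + snd t * v1 + q * w1, b + c i * w2 + snd t * v2 + q * w2) \<noteq> 0"
        by blast
      have eqs: "a + c i * w1 + snd t * v1 + q * w1 = a + snd t * v1 + (q + c i) * w1"
        "b + c i * w2 + snd t * v2 + q * w2 = b + snd t * v2 + (q + c i) * w2"
        by (simp_all add: algebra_simps)
      have "P t (q + c i)" using q(2-) unfolding P_def eqs by simp
      thus "\<exists>q. \<bar>q - c i\<bar> < e \<and> P t q" using q(1) by (intro exI[of _ "q + c i"]) simp
    qed
  qed simp
  hence "\<forall>\<^sub>F t in nhds (0, 0). \<exists>Q. finite Q \<and> card Q = d \<and> (\<forall>q\<in>Q. P t q)"
  proof (rule eventually_mono)
    fix t assume "\<forall>i\<in>{..<d}. \<exists>q. \<bar>q - c i\<bar> < e \<and> P t q"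
    then obtain q where q: "\<And>i. i < d \<Longrightarrow> \<bar>q i - c i\<bar> < e \<and> P t (q i)"
      unfolding Ball_def lessThan_iff by metis
    have "inj_on q {..<d}"
    proof (rule inj_onI)
      fix i j assume ij: "i \<in> {..<d}" "j \<in> {..<d}" "q i = q j"
      hence "\<bar>c i - c j\<bar> < 2 * e" using q[of i] q[of j] by auto
      hence "c i = c j" using e[of "c i" "c j"] ij by fastforce
      thus "i = j" using c ij by (auto simp: inj_on_def)
    qed
    thus "\<exists>Q. finite Q \<and> card Q = d \<and> (\<forall>q\<in>Q. P t q)"
      using q by (intro exI[of _ "q ` {..<d}"]) (auto simp: card_image)
  qed
  thus ?thesis by (simp only: P_def)
qed

text \<open>
  The pair \<open>(i, i)\<close> stands for the foot on the line \<open>i\<close>, and the pairs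
  \<open>(i, j)\<close> and \<open>(j, i)\<close> for the two normals near the node of the lines
  \<open>i\<close> and \<open>j\<close>. Normals of different origin have different \<open>u\<close>
  because the limit values are distinct: negative for the feet, positive for the nodes, with distinct
  sums \<open>\<beta>\<^sub>i + \<beta>\<^sub>j\<close>.
\<close>

lemma many_real_normals:
  "\<forall>\<^sub>F t in nhds (0, 0). 0 < fst t \<longrightarrow> (\<exists>U. finite U \<and> card U = d\<^sup>2 \<and>
     (\<forall>u\<in>U. \<exists>x. normal_foot (fst t) (fst t * snd t) u x))"
proof -
  define I where "I = {..<d} \<times> {..<d}"
  define c where "c = (\<lambda>(i, j). if i = j then - inverse (\<beta> i) else \<beta> i + \<beta> j)"
  have "finite I" by (simp add: I_def)
  obtain e where "e > 0" and e: "\<And>x y. x \<in> c ` I \<Longrightarrow> y \<in> c ` I \<Longrightarrow> x \<noteq> y \<Longrightarrow> 2 * e \<le> \<bar>x - y\<bar>"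
    using separation[of "c ` I"] \<open>finite I\<close> by auto
  define good where "good = (\<lambda>(t :: real \<times> real) p u. \<bar>u - c p\<bar> < e \<and>
     (fst p \<noteq> snd p \<longrightarrow> 0 < (u - c p) * (\<beta> (fst p) - \<beta> (snd p))) \<and>
     (\<exists>x. normal_foot (fst t) (fst t * snd t) u x))"
  have "\<forall>\<^sub>F t in nhds (0, 0). \<forall>p\<in>I. 0 < fst t \<longrightarrow> (\<exists>u. good t p u)"
  proof (intro eventually_ball_finite \<open>finite I\<close> ballI)
    fix p assume "p \<in> I"
    then obtain i j where p: "p = (i, j)" "i < d" "j < d" by (auto simp: I_def)
    show "\<forall>\<^sub>F t in nhds (0, 0). 0 < fst t \<longrightarrow> (\<exists>u. good t p u)"
    proof (cases "i = j")
      case True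
      show ?thesis
        by (rule eventually_mono[OF foot_persists[OF p(2) \<open>e > 0\<close>]])
           (auto simp: good_def p c_def True)
    next
      case False
      show ?thesis
        by (rule eventually_mono[OF node_persists[OF p(2,3) False \<open>e > 0\<close>]])
           (auto simp: good_def p c_def False)
    qed
  qed
  thus ?thesis
  proof (rule eventually_mono, intro impI)
    fix t :: "real \<times> real"
    assume "\<forall>p\<in>I. 0 < fst t \<longrightarrow> (\<exists>u. good t p u)" "0 < fst t"
    then obtain u where u: "\<And>p. p \<in> I \<Longrightarrow> good t p (u p)" by metis
    have "inj_on u I"
    proof (rule inj_onI)
      fix p q assume pq: "p \<in> I" "q \<in> I" "u p = u q"
      hence "\<bar>c p - c q\<bar> < 2 * e" using u[of p] u[of q] unfolding good_def by linarith
      hence cpq: "c p = c q" using e[of "c p" "c q"] pq by fastforce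
      obtain i j k l where p: "p = (i, j)" "i < d" "j < d" and q: "q = (k, l)" "k < d" "l < d"
        using pq by (auto simp: I_def)
      have neg: "- inverse (\<beta> a) < \<beta> b + \<beta> b'" for a b b'
        using pos[of b] pos[of b'] positive_imp_inverse_positive[OF pos[of a]] by linarith
      consider "i = j" "k = l" | "i \<noteq> j" "k \<noteq> l"
        using cpq neg[of i k l] neg[of k i j] by (auto simp: c_def p q split: if_splits)
      thus "p = q"
      proof cases
        case 1
        thus ?thesis using cpq \<beta>_eq_iff[of i k] p q by (simp add: c_def)
      next
        case 2
        hence "{i, j} = {k, l}" using cpq sidon[of i j k l] p q by (simp add: c_def)
        moreover have False if "i = l" "j = k"
        proof -
          have "0 < (u p - c p) * (\<beta> i - \<beta> j)" "0 < (u p - c p) * (\<beta> j - \<beta> i)"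
            using u[OF pq(1)] u[OF pq(2)] pq(3) cpq 2 that by (auto simp: good_def p q)
          thus False by (auto simp: zero_less_mult_iff)
        qed
        ultimately show ?thesis using p q by (auto simp: doubleton_eq_iff)
      qed
    qed
    hence "card (u ` I) = d\<^sup>2" by (simp add: card_image I_def power2_eq_square)
    thus "\<exists>U. finite U \<and> card U = d\<^sup>2 \<and> (\<forall>u\<in>U. \<exists>x. normal_foot (fst t) (fst t * snd t) u x)"
      using u \<open>finite I\<close> by (intro exI[of _ "u ` I"]) (auto simp: good_def)
  qed
qed

text \<open>
  Besides the real normals, the proof of the degree formula uses the \<open>d\<close> real points on
  vertical lines, which show that the equation generates the vanishing ideal of the curve and that the
  line \<open>x = 0\<close> is not a normal, and those on \<open>y = 0\<close>, which show that this
  line is not a normal either.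
\<close>

theorem good_parameters:
  obtains \<delta> \<rho> :: real where "0 < \<rho>"
    "\<And>s. \<bar>s\<bar> < \<rho> \<Longrightarrow> \<exists>U. finite U \<and> card U = d\<^sup>2 \<and> (\<forall>u\<in>U. \<exists>x. normal_foot \<delta> s u x)"
    "\<And>x. \<bar>x\<bar> < \<rho> \<Longrightarrow> \<exists>Y. finite Y \<and> card Y = d \<and>
       (\<forall>y\<in>Y. eval2 (curve \<delta>) (x, y) = 0 \<and> eval2 (curve_x \<delta>) (x, y) \<noteq> 0)"
    "\<exists>X. finite X \<and> card X = d \<and> (\<forall>x\<in>X. eval2 (curve \<delta>) (x, 0) = 0 \<and> eval2 (curve_y \<delta>) (x, 0) \<noteq> 0)"
    "eval2 (curve \<delta>) (0, 0) \<noteq> 0"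
proof -
  let ?c = "\<lambda>(t :: real \<times> real) (x :: real) (y :: real). eval2 (curve (fst t)) (x, y) = 0 \<and>
     eval2 (curve_x (fst t)) (x, y) \<noteq> 0 \<and> eval2 (curve_y (fst t)) (x, y) \<noteq> 0"
  have v: "\<forall>\<^sub>F t in nhds (0, 0). \<exists>Y. finite Y \<and> card Y = d \<and> (\<forall>y\<in>Y. ?c t (snd t) y)"
    using line_crossings[of 0 "\<lambda>i. inverse (\<beta> i)" 0 0 1 1 0] \<beta>_eq_iff
    by (simp add: eval2_line inj_on_def)
  have h: "\<forall>\<^sub>F t in nhds (0, 0). \<exists>X. finite X \<and> card X = d \<and> (\<forall>x\<in>X. ?c t x 0)"
  proof -
    have "inverse (\<beta> i) ^ 2 = inverse (\<beta> j) ^ 2 \<longleftrightarrow> \<beta> i = \<beta> j" for i j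
      using power2_eq_iff_nonneg[of "inverse (\<beta> i)" "inverse (\<beta> j)"] by (simp add: less_imp_le)
    thus ?thesis
      using line_crossings[of 0 "\<lambda>i. inverse (\<beta> i) ^ 2" 1 0 0 0 0] \<beta>_eq_iff
      by (simp add: eval2_line inj_on_def power2_eq_square)
  qed
  have n: "\<forall>\<^sub>F t in nhds (0, 0 :: real). eval2 (curve (fst t)) (0, 0) \<noteq> 0"
  proof -
    let ?h = "\<lambda>t :: real \<times> real. eval2 (curve (fst t)) (0, 0)"
    have "isCont ?h (0, 0)"
      unfolding eval2_curve[of "fst _"] by (intro continuous_intros)
    hence lim: "(?h \<longlongrightarrow> ?h (0, 0)) (nhds (0, 0))"
      unfolding isCont_def using tendsto_at_iff_tendsto_nhds[of ?h "(0, 0)"] by blast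
    have "?h (0, 0) \<noteq> 0"
      by (simp add: curve_def lines_def eval2_line)
    from tendsto_imp_eventually_ne[OF lim this] show ?thesis .
  qed
  from eventually_conj[OF many_real_normals eventually_conj[OF v eventually_conj[OF h n]]]
  obtain r where "r > 0" and r: "\<And>t. dist t (0, 0) < r \<Longrightarrow> (0 < fst t \<longrightarrow> (\<exists>U. finite U \<and> card U = d\<^sup>2 \<and>
     (\<forall>u\<in>U. \<exists>x. normal_foot (fst t) (fst t * snd t) u x))) \<and>
     (\<exists>Y. finite Y \<and> card Y = d \<and> (\<forall>y\<in>Y. ?c t (snd t) y)) \<and>
     (\<exists>X. finite X \<and> card X = d \<and> (\<forall>x\<in>X. ?c t x 0)) \<and> eval2 (curve (fst t)) (0, 0) \<noteq> 0"
    unfolding eventually_nhds_metric by blast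
  define \<delta> where "\<delta> = r / 2"
  have "\<delta> > 0" using \<open>r > 0\<close> by (simp add: \<delta>_def)
  have near: "dist (\<delta>, \<sigma>) (0, 0) < r" if "\<bar>\<sigma>\<bar> < \<delta>" for \<sigma>
  proof -
    have "dist (\<delta>, \<sigma>) (0, 0) \<le> \<bar>\<delta>\<bar> + \<bar>\<sigma>\<bar>"
      using sqrt_sum_squares_le_sum_abs[of \<delta> \<sigma>] by (simp add: dist_Pair_Pair)
    thus ?thesis using that \<open>\<delta> > 0\<close> by (simp add: \<delta>_def)
  qed
  \<comment> \<open>\<open>s = \<delta> \<sigma>\<close> with \<open>\<bar>\<sigma>\<bar> < \<delta>\<close> allows \<open>\<bar>s\<bar> < \<delta>\<^sup>2\<close>, and \<open>x = \<sigma>\<close> allows \<open>\<bar>x\<bar> < \<delta>\<close>\<close>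
  define \<rho> where "\<rho> = min \<delta> (\<delta> * \<delta>)"
  show ?thesis
  proof (rule that[of \<rho> \<delta>])
    show "0 < \<rho>" using \<open>\<delta> > 0\<close> by (simp add: \<rho>_def)
    show "\<exists>U. finite U \<and> card U = d\<^sup>2 \<and> (\<forall>u\<in>U. \<exists>x. normal_foot \<delta> s u x)" if "\<bar>s\<bar> < \<rho>" for s
    proof -
      have "\<bar>s / \<delta>\<bar> < \<delta>" using that \<open>\<delta> > 0\<close> by (simp add: \<rho>_def abs_divide divide_less_eq)
      from r[OF near[OF this]] \<open>\<delta> > 0\<close> show ?thesis by simp
    qed
    show "\<exists>Y. finite Y \<and> card Y = d \<and> (\<forall>y\<in>Y. eval2 (curve \<delta>) (x, y) = 0 \<and> eval2 (curve_x \<delta>) (x, y) \<noteq> 0)"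
      if "\<bar>x\<bar> < \<rho>" for x
      using r[OF near[of x]] that by (auto simp: \<rho>_def)
    show "\<exists>X. finite X \<and> card X = d \<and> (\<forall>x\<in>X. eval2 (curve \<delta>) (x, 0) = 0 \<and> eval2 (curve_y \<delta>) (x, 0) \<noteq> 0)"
      "eval2 (curve \<delta>) (0, 0) \<noteq> 0"
      using r[OF near[of 0]] \<open>\<delta> > 0\<close> by auto
  qed
qed

end

lemma powers_of_two_sidon:
  fixes i j k l :: nat
  assumes "i \<noteq> j" "k \<noteq> l" and eq: "(2 :: real) ^ i + 2 ^ j = 2 ^ k + 2 ^ l"
  shows "{i, j} = {k, l}"
proof -
  have larger: "\<not> b < b'" if "a < b" "(2 :: real) ^ a + 2 ^ b = 2 ^ a' + 2 ^ b'" for a b a' b' :: nat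
  proof
    assume "b < b'"
    have "(2 :: real) ^ a < 2 ^ b" using that(1) by simp
    moreover have "2 * 2 ^ b \<le> (2 :: real) ^ b'"
      using \<open>b < b'\<close> power_increasing[of "Suc b" b' "2 :: real"] by simp
    moreover have "(2 :: real) ^ a' > 0" by simp
    ultimately show False using that(2) by linarith
  qed
  have ordered: "a = a' \<and> b = b'" if "a < b" "a' < b'" "(2 :: real) ^ a + 2 ^ b = 2 ^ a' + 2 ^ b'"
    for a b a' b' :: nat
    using larger[OF that(1,3)] larger[OF that(2) that(3)[symmetric]] that(3) by (metis add_right_cancel linorder_neqE_nat
        one_less_numeral_iff power_inject_exp semiring_norm(76))
  show ?thesis
    using ordered[of i j k l] ordered[of i j l k] ordered[of j i k l] ordered[of j i l k] assms
    by (cases "i < j"; cases "k < l") (auto simp: add.commute)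
qed

interpretation powers_of_two: line_arrangement d "\<lambda>k. 2 ^ k" for d
  by standard (auto simp: inj_on_def dest: powers_of_two_sidon)


section \<open>Normals of a curve with known equation\<close>

text \<open>
  When \<open>F\<close> generates the vanishing ideal, the Zariski tangent space at a point of the curve
  is the kernel of the gradient of \<open>F\<close>.
\<close>

locale plane_curve =
  fixes \<Gamma> :: "(real \<times> real) set" and F :: "real poly poly"
  assumes ideal: "vanishing_ideal \<Gamma> = {g. F dvd g}"
    and zero_set: "\<Gamma> = {p. eval2 F p = 0}"
begin

abbreviation "Fc \<equiv> complex_poly2 F"
abbreviation "Fx \<equiv> complex_poly2 (partial_x F)"
abbreviation "Fy \<equiv> complex_poly2 (partial_y F)"

lemma complexification_iff: "p \<in> complexification \<Gamma> \<longleftrightarrow> eval2 Fc p = 0"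
  unfolding complexification_def ideal by (auto simp: complex_poly2_mult elim!: dvdE)

lemma tangent_space_iff:
  assumes "eval2 Fc p = 0"
  shows "w \<in> tangent_space \<Gamma> p \<longleftrightarrow> eval2 Fx p * fst w + eval2 Fy p * snd w = 0"
proof
  assume "w \<in> tangent_space \<Gamma> p"
  thus "eval2 Fx p * fst w + eval2 Fy p * snd w = 0"
    by (auto simp: tangent_space_def ideal partial_x_complex_poly2 partial_y_complex_poly2)
next
  assume w: "eval2 Fx p * fst w + eval2 Fy p * snd w = 0"
  show "w \<in> tangent_space \<Gamma> p"
    unfolding tangent_space_def ideal
  proof safe
    fix g assume "F dvd g"
    then obtain h where h: "g = F * h" by (elim dvdE)
    have "eval2 (partial_x (complex_poly2 g)) p * fst w + eval2 (partial_y (complex_poly2 g)) p * snd w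
        = eval2 (complex_poly2 h) p * (eval2 Fx p * fst w + eval2 Fy p * snd w)"
      by (simp add: h complex_poly2_mult partial_x_mult partial_y_mult assms
          partial_x_complex_poly2 partial_y_complex_poly2 algebra_simps)
    thus "eval2 (partial_x (complex_poly2 g)) p * fst w + eval2 (partial_y (complex_poly2 g)) p * snd w = 0"
      by (simp add: w)
  qed
qed

lemma normal_is_complex_normal: "real_normals \<Gamma> \<subseteq> complex_normals \<Gamma>"
proof -
  have "complex_point p \<in> complexification \<Gamma>" if "p \<in> \<Gamma>" for p
    using that by (simp add: complexification_iff eval2_complex_poly2) (simp add: zero_set)
  thus ?thesis unfolding real_normals_def complex_normals_def by blast
qed

lemma dual_line_real_normalI:
  assumes "eval2 F (x, y) = 0" "y + u * x + v = 0"
    and "eval2 (partial_y F) (x, y) + u * eval2 (partial_x F) (x, y) = 0"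
    and "eval2 (partial_x F) (x, y) \<noteq> 0"
  shows "dual_line (complex_point (u, v)) \<in> real_normals \<Gamma>"
proof -
  let ?p = "complex_point (x, y)" and ?w = "(complex_of_real u, 1 :: complex)"
  let ?a = "complex_of_real (eval2 (partial_x F) (x, y))"
  have F: "eval2 Fc ?p = 0" using assms(1) by (simp add: eval2_complex_poly2)
  have Fx: "eval2 Fx ?p = ?a" by (simp add: eval2_complex_poly2)
  have "eval2 (partial_y F) (x, y) = - u * eval2 (partial_x F) (x, y)" using assms(3) by simp
  hence Fy: "eval2 Fy ?p = - of_real u * ?a" by (simp add: eval2_complex_poly2)
  have "w \<in> tangent_space \<Gamma> ?p \<longleftrightarrow> fst w = of_real u * snd w" for w
  proof -
    have "eval2 Fx ?p * fst w + eval2 Fy ?p * snd w = ?a * (fst w - of_real u * snd w)"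
      unfolding Fx Fy by (simp add: algebra_simps)
    thus ?thesis using assms(4) by (simp add: tangent_space_iff[OF F])
  qed
  hence "tangent_space \<Gamma> ?p = range (\<lambda>c. (c * fst ?w, c * snd ?w))"
    by (auto simp: image_iff mult.commute)
  hence "tangent_direction \<Gamma> ?p ?w" by (simp add: tangent_direction_def zero_prod_def)
  moreover have "dual_line (complex_point (u, v)) = {q. bilinear_form (q - ?p) ?w = 0}"
  proof -
    have "v = - y - u * x" using assms(2) by simp
    hence v: "complex_of_real v = - of_real y - of_real u * of_real x" by simp
    show ?thesis
      by (auto simp: dual_line_def bilinear_form_def complex_point_def v algebra_simps)
  qed
  ultimately show ?thesis
    unfolding real_normals_def normals_at_def using assms(1) by (auto simp: zero_set)
qed

lemma complex_normalE:
  assumes "N \<in> complex_normals \<Gamma>"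
  obtains x y w where "eval2 Fc (x, y) = 0" "w \<noteq> 0"
    "eval2 Fx (x, y) * fst w + eval2 Fy (x, y) * snd w = 0"
    "N = {q. bilinear_form (q - (x, y)) w = 0}"
proof -
  obtain p w where p: "eval2 Fc p = 0" and w: "tangent_direction \<Gamma> p w"
      and N: "N = {q. bilinear_form (q - p) w = 0}"
    using assms by (auto simp: complex_normals_def normals_at_def complexification_iff)
  have "w \<in> range (\<lambda>c. (c * fst w, c * snd w))" by (auto intro!: image_eqI[of _ _ 1])
  hence "w \<in> tangent_space \<Gamma> p" using w by (simp add: tangent_direction_def)
  thus ?thesis
    using that[of "fst p" "snd p" w] p w N by (simp add: tangent_space_iff tangent_direction_def)
qed

lemma dual_line_complex_normalE:
  assumes "dual_line (u, v) \<in> complex_normals \<Gamma>"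
  obtains x y where "y = - u * x - v" "eval2 Fc (x, y) = 0"
    "eval2 Fy (x, y) + u * eval2 Fx (x, y) = 0"
proof -
  obtain x y w where p: "eval2 Fc (x, y) = 0" and "w \<noteq> 0"
    and w: "eval2 Fx (x, y) * fst w + eval2 Fy (x, y) * snd w = 0"
    and N: "dual_line (u, v) = {q. bilinear_form (q - (x, y)) w = 0}"
    using complex_normalE[OF assms] by metis
  have "(x, y) \<in> dual_line (u, v)" unfolding N by (simp add: bilinear_form_def)
  hence y: "y = - u * x - v" by (simp add: dual_line_def algebra_simps eq_neg_iff_add_eq_0)
  have "(x + 1, y - u) \<in> dual_line (u, v)" by (simp add: dual_line_def y algebra_simps)
  hence w1: "fst w = u * snd w" unfolding N by (simp add: bilinear_form_def algebra_simps)
  hence "snd w \<noteq> 0" using \<open>w \<noteq> 0\<close> by (metis mult_zero_right prod.collapse zero_prod_def)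
  moreover have "snd w * (eval2 Fy (x, y) + u * eval2 Fx (x, y)) = 0"
    using w unfolding w1 by (simp add: algebra_simps)
  ultimately show ?thesis using that[OF y p] by simp
qed

text \<open>
  Only vertical lines are missing in the affine chart of the dual plane, and by hypothesis the vertical
  line through the origin is not a normal.
\<close>

lemma complex_normal_through_origin:
  assumes "N \<in> complex_normals \<Gamma>" "(0, 0) \<in> N"
    and not_vertical: "\<And>y. eval2 Fc (0, y) = 0 \<Longrightarrow> eval2 Fx (0, y) \<noteq> 0"
  obtains u where "N = dual_line (u, 0)"
proof -
  obtain x y w where p: "eval2 Fc (x, y) = 0" and "w \<noteq> 0"
    and w: "eval2 Fx (x, y) * fst w + eval2 Fy (x, y) * snd w = 0"
    and N: "N = {q. bilinear_form (q - (x, y)) w = 0}"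
    using complex_normalE[OF assms(1)] by metis
  have "- (x * fst w) - y * snd w = 0"
    using assms(2) unfolding N by (simp add: bilinear_form_def)
  hence 0: "x * fst w + y * snd w = 0"
    by (metis add.inverse_inverse add.inverse_neutral minus_add_distrib diff_conv_add_uminus)
  have "snd w \<noteq> 0"
  proof
    assume "snd w = 0"
    hence "fst w \<noteq> 0" using \<open>w \<noteq> 0\<close> by (metis prod.collapse zero_prod_def)
    hence "x = 0" "eval2 Fx (x, y) = 0" using 0 w \<open>snd w = 0\<close> by auto
    thus False using not_vertical p by blast
  qed
  have "bilinear_form (q - (x, y)) w = snd w * (snd q + fst w / snd w * fst q)" for q
    using 0 \<open>snd w \<noteq> 0\<close> by (simp add: bilinear_form_def field_simps)
  hence "N = dual_line (fst w / snd w, 0)"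
    unfolding N dual_line_def using \<open>snd w \<noteq> 0\<close> by auto
  thus ?thesis by (rule that)
qed

end

lemma inj_dual_line: "inj dual_line"
proof
  fix p q :: "complex \<times> complex"
  assume eq: "dual_line p = dual_line q"
  have "(0, - snd p) \<in> dual_line p" "(1, - fst p - snd p) \<in> dual_line p"
    by (simp_all add: dual_line_def)
  hence "- snd p + snd q = 0" "- fst p - snd p + fst q + snd q = 0"
    unfolding eq by (simp_all add: dual_line_def)
  thus "p = q" by (simp add: prod_eq_iff algebra_simps)
qed


section \<open>The degree of the curve of normals\<close>

lemma fibre_polynomial:
  fixes f :: "'a::comm_ring_1 poly poly"
  assumes deg: "total_degree_le n f"
  obtains P where "\<And>y. poly P y = eval2 f (x, y)" "degree P \<le> n" "coeff P n = coeff (coeff f n) 0"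
proof
  let ?P = "map_poly (\<lambda>c. poly c x) f"
  show "poly ?P y = eval2 f (x, y)" for y by (rule poly_map_poly_eval)
  have "degree f \<le> n"
  proof (rule degree_le, intro allI impI)
    fix j assume "n < j"
    thus "coeff f j = 0" by (intro poly_eqI) (simp add: total_degree_leD[OF deg])
  qed
  thus "degree ?P \<le> n" using map_poly_degree_leq[of "\<lambda>c. poly c x" f] by linarith
  have "degree (coeff f n) \<le> 0"
    by (rule degree_le) (simp add: total_degree_leD[OF deg])
  hence "degree (coeff f n) = 0" by simp
  then obtain c where "coeff f n = [:c:]" by (rule degree_eq_zeroE)
  thus "coeff ?P n = coeff (coeff f n) 0" by (simp add: coeff_map_poly)
qed

text \<open>
  A polynomial of total degree at most \<open>n\<close> restricts to a fibre of the first coordinate as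
  a polynomial of degree at most \<open>n\<close>, whose coefficient of \<open>y\<^sup>n\<close> does
  not depend on the fibre.
\<close>

lemma eval2_fibre_prod:
  fixes f :: "'a::field_char_0 poly poly"
  assumes deg: "total_degree_le n f" and Y: "finite Y" "card Y = n" "\<And>y. y \<in> Y \<Longrightarrow> eval2 f (x, y) = 0"
  shows "eval2 f (x, y) = coeff (coeff f n) 0 * (\<Prod>y'\<in>Y. y - y')"
proof -
  let ?c = "coeff (coeff f n) 0"
  obtain P where P: "\<And>y. poly P y = eval2 f (x, y)" "degree P \<le> n" "coeff P n = ?c"
    using fibre_polynomial[OF deg] by blast
  let ?Q = "smult ?c (\<Prod>y'\<in>Y. [:- y', 1:])"
  have degprod: "degree (\<Prod>y'\<in>Y. [:- y', 1:]) = n"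
    using Y(2) by (subst degree_prod_eq_sum_degree) auto
  have "lead_coeff (\<Prod>y'\<in>Y. [:- y', 1:]) = 1" by (simp add: lead_coeff_prod)
  hence cQ: "coeff ?Q n = ?c" by (simp add: degprod)
  have "P = ?Q"
  proof (rule poly_eqI_degree_lead_coeff[where n = n and A = Y])
    show "degree ?Q \<le> n" using degree_smult_le[of ?c "\<Prod>y'\<in>Y. [:- y', 1:]"] degprod by simp
    fix y assume "y \<in> Y"
    hence "(\<Prod>y'\<in>Y. y - y') = 0" using Y(1) by auto
    thus "poly P y = poly ?Q y" using \<open>y \<in> Y\<close> Y(3) by (simp add: P poly_prod)
  qed (use Y P cQ in auto)
  thus ?thesis by (simp add: P(1)[symmetric] poly_prod)
qed

lemma finite_fibre:
  fixes f :: "'a::field_char_0 poly poly"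
  assumes deg: "total_degree_le n f" and "coeff (coeff f n) 0 \<noteq> 0"
  shows "finite {y. eval2 f (x, y) = 0}"
proof -
  obtain P where P: "\<And>y. poly P y = eval2 f (x, y)" "coeff P n = coeff (coeff f n) 0"
    using fibre_polynomial[OF deg] by blast
  hence "P \<noteq> 0" using assms(2) by auto
  thus ?thesis using poly_roots_finite[of P] by (simp add: P)
qed

lemma real_polynomial_function_zero:
  fixes g :: "real \<Rightarrow> real"
  assumes "real_polynomial_function g" "infinite T" "\<And>t. t \<in> T \<Longrightarrow> g t = 0"
  shows "g t = 0"
proof -
  obtain a n where g: "g = (\<lambda>x. \<Sum>i\<le>n. a i * x ^ i)"
    using assms(1) by (auto simp: real_polynomial_function_iff_sum)
  define p where "p = (\<Sum>i\<le>n. monom (a i) i)"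
  have p: "poly p x = g x" for x by (simp add: p_def g poly_sum poly_monom)
  have "T \<subseteq> {x. poly p x = 0}" using assms(3) by (auto simp: p)
  hence "p = 0" using assms(2) poly_roots_finite finite_subset by blast
  thus ?thesis using p by (metis poly_0)
qed

text \<open>
  If infinitely many points of \<open>H\<close> lie on a line, then every polynomial that vanishes on
  \<open>H\<close> vanishes on the line, so its differential annihilates the direction of the line.
\<close>

lemma transversal_finite:
  assumes "transversal_at H w (a + t *\<^sub>R w)"
  shows "finite {t. a + t *\<^sub>R w \<in> H}"
proof (rule ccontr)
  assume inf: "infinite {t. a + t *\<^sub>R w \<in> H}"
  obtain G D where G: "real_polynomial_function G" "\<forall>x\<in>H. G x = 0"
      and D: "(G has_derivative D) (at (a + t *\<^sub>R w))" "D w \<noteq> 0"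
    using assms by (auto simp: transversal_at_def)
  have "polynomial_function (\<lambda>t :: real. a + t *\<^sub>R w)"
    by (intro polynomial_function_add polynomial_function_const
        polynomial_function_mult[of "\<lambda>t. t" "\<lambda>t. w"]) (auto intro: polynomial_function_id)
  hence "real_polynomial_function (\<lambda>t. G (a + t *\<^sub>R w))"
    using real_polynomial_function_compose[OF _ G(1)] by (simp add: o_def)
  hence 0: "G (a + s *\<^sub>R w) = 0" for s
    using real_polynomial_function_zero[OF _ inf] G(2) by blast
  have "((\<lambda>s. a + s *\<^sub>R w) has_derivative (\<lambda>h. h *\<^sub>R w)) (at t)"
    by (auto intro!: derivative_eq_intros)
  hence "((\<lambda>s. G (a + s *\<^sub>R w)) has_derivative (\<lambda>h. D (h *\<^sub>R w))) (at t)"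
    using has_derivative_compose[of "\<lambda>s. a + s *\<^sub>R w" _ t UNIV G D] D(1) by simp
  hence "(\<lambda>h. D (h *\<^sub>R w)) = (\<lambda>h. 0)"
    unfolding 0 by (rule has_derivative_unique) (rule has_derivative_const)
  hence "D (1 *\<^sub>R w) = 0" by metis
  thus False using D(2) by simp
qed

lemma Re_mult_of_real: "Re (z * of_real x) = Re z * x"
  by simp

lemma real_polynomial_function_Re_eval2:
  "real_polynomial_function (\<lambda>p. Re (eval2 R (complex_point p) / c))"
proof -
  have Re_term: "Re (b * of_real x ^ i * of_real y ^ j / c) = Re (b / c) * x ^ i * y ^ j"
    for b :: complex and x y :: real and i j
  proof -
    have "b * of_real x ^ i * of_real y ^ j / c = (b / c) * of_real (x ^ i * y ^ j)" by simp
    thus ?thesis by (simp only: Re_mult_of_real mult.assoc)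
  qed
  have "Re (eval2 R (complex_point p) / c) =
      (\<Sum>j\<le>degree R. \<Sum>i\<le>degree (coeff R j). Re (coeff (coeff R j) i / c) * fst p ^ i * snd p ^ j)" for p
    by (simp only: eval2_altdef poly_altdef complex_point_def sum_distrib_right sum_divide_distrib
        Re_sum fst_conv snd_conv Re_term)
  moreover have "real_polynomial_function (\<lambda>p. \<Sum>j\<le>degree R. \<Sum>i\<le>degree (coeff R j).
      Re (coeff (coeff R j) i / c) * fst p ^ i * (snd p :: real) ^ j)"
    by (intro real_polynomial_function_sum real_polynomial_function.intros(4) real_polynomial_function_power
        real_polynomial_function.intros(1,2) bounded_linear_fst bounded_linear_snd) auto
  ultimately show ?thesis by presburger
qed

text \<open>
  How the real points and real normals determine both curves. The polynomial \<open>R\<close> has on each line \<open>v\<close> constant,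
  \<open>v\<close> real and small, exactly the \<open>d\<^sup>2\<close> given real roots \<open>U v\<close>. The fibres in question are those of the second
  coordinate, whence the exchange of the variables.

  For the upper bound on the \<open>\<real>\<close>-degree, a line on which \<open>R\<close> is not identically zero meets the curve in at most
  \<open>d\<^sup>2\<close> points. A line on which \<open>R\<close> vanishes identically is not parallel to the lines above, so it meets all
  of them, at zeros of \<open>R\<close>, which are real normals. Thus it contains infinitely many points of the curve
  and is not transversal to it.
\<close>

lemma degree_of_curve_of_normals:
  fixes F :: "real poly poly" and d :: nat and \<rho> :: real
  defines "\<Gamma> \<equiv> {p. eval2 F p = 0}"
  assumes "d > 0" and F: "total_degree_le d F" and "\<rho> > 0"
    and normals: "\<And>s. \<bar>s\<bar> < \<rho> \<Longrightarrow> \<exists>U. finite U \<and> card U = d\<^sup>2 \<and> (\<forall>u\<in>U. \<exists>x.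
          eval2 F (x, s - u * x) = 0 \<and> normal_deriv u F (x, s - u * x) = 0 \<and>
          eval2 (partial_x F) (x, s - u * x) \<noteq> 0)"
    and vertical: "\<And>x. \<bar>x\<bar> < \<rho> \<Longrightarrow> \<exists>Y. finite Y \<and> card Y = d \<and>
          (\<forall>y\<in>Y. eval2 F (x, y) = 0 \<and> eval2 (partial_x F) (x, y) \<noteq> 0)"
    and horizontal: "\<exists>X. finite X \<and> card X = d \<and>
          (\<forall>x\<in>X. eval2 F (x, 0) = 0 \<and> eval2 (partial_y F) (x, 0) \<noteq> 0)"
    and nz: "eval2 F (0, 0) \<noteq> 0"
  shows "real_algebraic_curve \<Gamma> d \<and>
     card {N \<in> complex_normals \<Gamma>. complex_point (0, 0) \<in> N} = d\<^sup>2 \<and>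
     {N \<in> complex_normals \<Gamma>. complex_point (0, 0) \<in> N} \<subseteq> real_normals \<Gamma> \<and>
     has_curve_degree (complex_curve_of_normals \<Gamma>) (d\<^sup>2) \<and>
     R_degree (real_curve_of_normals \<Gamma>) = enat (d\<^sup>2)"
proof -
  have strip: "infinite {- \<rho><..<\<rho>}" using \<open>\<rho> > 0\<close> by (simp add: infinite_Ioo)
  have "F \<noteq> 0" using nz by auto
  have fibre: "\<exists>Y. finite Y \<and> card Y = d \<and> (\<forall>y\<in>Y. (x, y) \<in> \<Gamma>)" if "x \<in> {- \<rho><..<\<rho>}" for x
  proof -
    obtain Y where "finite Y" "card Y = d" "\<forall>y\<in>Y. eval2 F (x, y) = 0 \<and> eval2 (partial_x F) (x, y) \<noteq> 0"
      using vertical[of x] \<open>x \<in> {- \<rho><..<\<rho>}\<close> unfolding greaterThanLessThan_iff abs_less_iff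
      by (metis minus_less_iff)
    thus ?thesis unfolding \<Gamma>_def by (intro exI[of _ Y]) simp
  qed
  have van: "eval2 F p = 0" if "p \<in> \<Gamma>" for p using that by (simp add: \<Gamma>_def)
  note curve_ideal = principal_vanishing_ideal[OF \<open>F \<noteq> 0\<close> F van strip fibre]
  interpret plane_curve \<Gamma> F
    by standard (use curve_ideal(1) in \<open>auto simp: \<Gamma>_def\<close>)
  have curve: "real_algebraic_curve \<Gamma> d"
    unfolding real_algebraic_curve_def has_curve_degree_def
    using \<open>d > 0\<close> curve_ideal(1,3) zero_set by blast

  let ?N = "complex_curve_of_normals \<Gamma>" and ?H = "real_curve_of_normals \<Gamma>" and ?n = "d\<^sup>2"
  define U where "U = (\<lambda>v. SOME U. finite U \<and> card U = ?n \<and> (\<forall>u\<in>U. (u, v) \<in> ?H))"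
  have U: "finite (U v) \<and> card (U v) = ?n \<and> (\<forall>u\<in>U v. (u, v) \<in> ?H)" if "\<bar>v\<bar> < \<rho>" for v
  proof -
    obtain V where V: "finite V" "card V = ?n" "\<forall>u\<in>V. \<exists>x. eval2 F (x, - v - u * x) = 0 \<and>
        normal_deriv u F (x, - v - u * x) = 0 \<and> eval2 (partial_x F) (x, - v - u * x) \<noteq> 0"
      using normals[of "- v"] \<open>\<bar>v\<bar> < \<rho>\<close> by auto
    have "(u, v) \<in> ?H" if "u \<in> V" for u
    proof -
      obtain x where x: "eval2 F (x, - v - u * x) = 0"
        "normal_deriv u F (x, - v - u * x) = 0" "eval2 (partial_x F) (x, - v - u * x) \<noteq> 0"
        using V(3) \<open>u \<in> V\<close> by blast
      thus ?thesis unfolding real_curve_of_normals_def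
        using dual_line_real_normalI[OF x(1) _ _ x(3)] by (simp add: normal_deriv_def)
    qed
    hence "\<exists>V. finite V \<and> card V = ?n \<and> (\<forall>u\<in>V. (u, v) \<in> ?H)" using V by blast
    thus ?thesis unfolding U_def by (rule someI_ex)
  qed
  have H_N: "complex_point p \<in> ?N" if "p \<in> ?H" for p
    using that normal_is_complex_normal
    by (auto simp: real_curve_of_normals_def complex_curve_of_normals_def)

  obtain X where X: "card X = d" "\<And>x. x \<in> X \<Longrightarrow> eval2 F (x, 0) = 0 \<and> eval2 (partial_y F) (x, 0) \<noteq> 0"
    using horizontal by blast
  have eval_c: "eval2 (complex_poly2 f) (of_real x, of_real y) = of_real (eval2 f (x, y))" for f x y
    using eval2_complex_poly2[of f "(x, y)"] by (simp add: complex_point_def)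
  obtain R where R: "R \<noteq> 0" "total_degree_le ?n R"
    and R0: "\<And>u v x y. y = - u * x - v \<Longrightarrow> eval2 Fc (x, y) = 0 \<Longrightarrow>
           eval2 (partial_y Fc) (x, y) + u * eval2 (partial_x Fc) (x, y) = 0 \<Longrightarrow> eval2 R (u, v) = 0"
  proof (rule normal_polynomial_exists[of d Fc "complex_of_real ` X" 0])
    show "total_degree_le d Fc" using F by (simp add: total_degree_le_complex_poly2)
    show "card (complex_of_real ` X) = d" using X(1) by (simp add: card_image inj_on_def)
    show "eval2 Fc (x, 0) = 0 \<and> eval2 (partial_y Fc) (x, 0) \<noteq> 0" if "x \<in> complex_of_real ` X" for x
      using that X(2) eval_c[of _ _ 0] by (auto simp: partial_y_complex_poly2)
    show "eval2 Fc (0, 0) \<noteq> 0" using nz eval_c[of F 0 0] by simp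
  qed (use \<open>d > 0\<close> in auto)
  have R_N: "eval2 R p = 0" if "p \<in> ?N" for p
  proof -
    obtain u v where p: "p = (u, v)" by (cases p)
    hence "dual_line (u, v) \<in> complex_normals \<Gamma>" using that by (simp add: complex_curve_of_normals_def)
    then obtain x y where "y = - u * x - v" "eval2 Fc (x, y) = 0" "eval2 Fy (x, y) + u * eval2 Fx (x, y) = 0"
      by (rule dual_line_complex_normalE)
    thus ?thesis unfolding p by (intro R0) (auto simp: partial_x_complex_poly2 partial_y_complex_poly2)
  qed

  \<comment> \<open>the fibres of \<open>v\<close> over the small real numbers make \<open>R\<close> a generator of the ideal\<close>
  let ?S = "{(v, u). (u, v) \<in> ?N}" and ?R = "swap_vars R"
  have Rs: "?R \<noteq> 0" "total_degree_le ?n ?R"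
    using R swap_vars_swap_vars[of R] by (auto simp: total_degree_le_swap_vars swap_vars_def[of 0])
  have van': "eval2 ?R p = 0" if "p \<in> ?S" for p
    using that R_N by (auto simp: eval2_swap_vars)
  have strip': "infinite (complex_of_real ` {- \<rho><..<\<rho>})"
    using strip by (simp add: finite_image_iff inj_on_def)
  have fibre': "\<exists>Y. finite Y \<and> card Y = ?n \<and> (\<forall>y\<in>Y. (x, y) \<in> ?S)"
    if "x \<in> complex_of_real ` {- \<rho><..<\<rho>}" for x
  proof -
    obtain v where v: "x = of_real v" "\<bar>v\<bar> < \<rho>"
      using \<open>x \<in> complex_of_real ` {- \<rho><..<\<rho>}\<close> by auto
    show ?thesis
      using U[OF v(2)] H_N[of "(_, v)"]
      by (intro exI[of _ "complex_of_real ` U v"]) (auto simp: card_image inj_on_def v complex_point_def)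
  qed
  note normals_ideal = principal_vanishing_ideal[OF Rs van' strip' fibre']
  have "vanishing_ideal ?N = {g. R dvd g}"
  proof -
    have "g \<in> vanishing_ideal ?N \<longleftrightarrow> swap_vars g \<in> vanishing_ideal ?S" for g
      by (auto simp: vanishing_ideal_def eval2_swap_vars)
    moreover have "?R dvd swap_vars g \<longleftrightarrow> R dvd g" for g
      by (metis dvd_def swap_vars_mult swap_vars_swap_vars)
    ultimately show ?thesis using normals_ideal(1) by auto
  qed
  moreover have "total_degree R = ?n" using normals_ideal(3) by (simp add: total_degree_swap_vars)
  ultimately have normals_degree: "has_curve_degree ?N ?n"
    unfolding has_curve_degree_def using \<open>d > 0\<close> by auto

  define c where "c = coeff (coeff ?R ?n) 0"
  have "c \<noteq> 0" using normals_ideal(2) by (simp add: c_def)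
  have R_prod: "eval2 R (u, of_real v) = c * (\<Prod>u'\<in>U v. u - of_real u')" if "\<bar>v\<bar> < \<rho>" for u v
  proof -
    have "eval2 R (of_real u', of_real v) = 0" if "u' \<in> U v" for u'
      using R_N[OF H_N[of "(u', v)"]] U[OF \<open>\<bar>v\<bar> < \<rho>\<close>] that by (simp add: complex_point_def)
    hence "eval2 ?R (of_real v, u) = c * (\<Prod>u'\<in>complex_of_real ` U v. u - u')"
      unfolding c_def using U[OF that]
      by (intro eval2_fibre_prod Rs) (auto simp: card_image inj_on_def eval2_swap_vars)
    thus ?thesis by (simp add: eval2_swap_vars prod.reindex inj_on_def)
  qed
  have R_iff: "eval2 R (u, of_real v) = 0 \<longleftrightarrow> u \<in> complex_of_real ` U v" if "\<bar>v\<bar> < \<rho>" for u v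
    using R_prod[OF that] \<open>c \<noteq> 0\<close> U[OF that] by auto

  let ?L = "{N \<in> complex_normals \<Gamma>. complex_point (0, 0) \<in> N}"
  have not_vertical: "eval2 Fx (0, y) \<noteq> 0" if "eval2 Fc (0, y) = 0" for y
  proof -
    obtain Y where Y: "finite Y" "card Y = d" "\<And>y. y \<in> Y \<Longrightarrow> eval2 F (0, y) = 0 \<and> eval2 (partial_x F) (0, y) \<noteq> 0"
      using vertical[of 0] \<open>\<rho> > 0\<close> by auto
    have "eval2 Fc (0, y) = coeff (coeff Fc d) 0 * (\<Prod>y'\<in>complex_of_real ` Y. y - y')"
      using Y eval_c[of _ 0] F
      by (intro eval2_fibre_prod) (auto simp: total_degree_le_complex_poly2 card_image inj_on_def)
    moreover have "coeff (coeff Fc d) 0 \<noteq> 0" using curve_ideal(2) by (simp add: coeff_complex_poly2)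
    ultimately obtain y' where "y' \<in> Y" "y = of_real y'"
      using \<open>eval2 Fc (0, y) = 0\<close> Y(1) by auto
    thus ?thesis using Y(3) eval_c[of _ 0 y'] by auto
  qed
  have L: "?L = (\<lambda>u. dual_line (complex_point (u, 0))) ` U 0"
  proof (intro equalityI subsetI)
    fix N assume N: "N \<in> ?L"
    then obtain u where u: "N = dual_line (u, 0)"
      using complex_normal_through_origin[of N] not_vertical by (auto simp: complex_point_def)
    hence "(u, 0) \<in> ?N" using N by (auto simp: complex_curve_of_normals_def)
    hence "u \<in> complex_of_real ` U 0" using R_N R_iff[of 0 u] \<open>\<rho> > 0\<close> by force
    thus "N \<in> (\<lambda>u. dual_line (complex_point (u, 0))) ` U 0" using u by (auto simp: complex_point_def)
  next
    fix N assume "N \<in> (\<lambda>u. dual_line (complex_point (u, 0))) ` U 0"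
    then obtain u where u: "u \<in> U 0" "N = dual_line (complex_point (u, 0))" by blast
    hence "complex_point (u, 0) \<in> ?N" using U[of 0] H_N \<open>\<rho> > 0\<close> by auto
    thus "N \<in> ?L" using u by (simp add: complex_curve_of_normals_def) (simp add: dual_line_def complex_point_def)
  qed
  have "inj_on (\<lambda>u. dual_line (complex_point (u, 0))) (U 0)"
  proof (rule inj_onI)
    fix u u' assume "dual_line (complex_point (u, 0)) = dual_line (complex_point (u', 0))"
    from injD[OF inj_dual_line this] show "u = u'" by (simp add: complex_point_def)
  qed
  hence L_card: "card ?L = ?n" using U[of 0] \<open>\<rho> > 0\<close> by (simp add: L card_image)
  have L_real: "?L \<subseteq> real_normals \<Gamma>"
    unfolding L using U[of 0] \<open>\<rho> > 0\<close> by (auto simp: real_curve_of_normals_def)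

  have "R_degree ?H = enat ?n"
  proof (rule antisym)
    show "R_degree ?H \<le> enat ?n"
      unfolding R_degree_def
    proof (rule Sup_least, safe)
      fix a w :: "real \<times> real"
      assume "w \<noteq> 0" and trans: "\<forall>q\<in>?H \<inter> affine_line a w. transversal_at ?H w q"
      define T where "T = {t. a + t *\<^sub>R w \<in> ?H}"
      have HT: "?H \<inter> affine_line a w = (\<lambda>t. a + t *\<^sub>R w) ` T"
        by (auto simp: affine_line_def T_def)
      define X where "X = [:complex_of_real (fst a), of_real (fst w):]"
      define Y where "Y = [:complex_of_real (snd a), of_real (snd w):]"
      define p where "p = compose2 R X Y"
      have p: "poly p (of_real t) = eval2 R (complex_point (a + t *\<^sub>R w))" for t
        by (simp add: p_def poly_compose2 X_def Y_def complex_point_def algebra_simps)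
      have T: "finite T" if "T \<noteq> {}"
      proof -
        obtain t where "t \<in> T" using \<open>T \<noteq> {}\<close> by blast
        hence "transversal_at ?H w (a + t *\<^sub>R w)" using trans HT by blast
        thus ?thesis unfolding T_def by (rule transversal_finite)
      qed
      have "p \<noteq> 0"
      proof
        assume "p = 0"
        show False
        proof (cases "snd w = 0")
          case True
          hence w: "fst w \<noteq> 0" using \<open>w \<noteq> 0\<close> by (auto simp: prod_eq_iff)
          have "eval2 ?R (of_real (snd a), u) = 0" for u
          proof -
            have "poly p ((u - of_real (fst a)) / of_real (fst w)) = 0" by (simp add: \<open>p = 0\<close>)
            thus ?thesis using w True by (simp add: p_def poly_compose2 X_def Y_def eval2_swap_vars)
          qed
          hence "finite (UNIV :: complex set)"
            using finite_fibre[OF Rs(2) normals_ideal(2), of "of_real (snd a)"] by simp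
          thus False by (simp add: infinite_UNIV_char_0)
        next
          case False
          have "(v - snd a) / snd w \<in> T" if "v \<in> {- \<rho><..<\<rho>}" for v
          proof -
            define t where "t = (v - snd a) / snd w"
            have "snd a + t * snd w = v" using False by (simp add: t_def)
            hence at: "a + t *\<^sub>R w = (fst a + t * fst w, v)" by (simp add: prod_eq_iff)
            have "\<bar>v\<bar> < \<rho>" using that by auto
            have "eval2 R (of_real (fst a + t * fst w), of_real v) = 0"
              using p[of t] unfolding at \<open>p = 0\<close> by (simp add: complex_point_def)
            hence "fst a + t * fst w \<in> U v" using R_iff[OF \<open>\<bar>v\<bar> < \<rho>\<close>] by (auto simp: image_iff simp del: of_real_add of_real_mult)
            thus ?thesis using U[OF \<open>\<bar>v\<bar> < \<rho>\<close>] by (simp add: T_def at[symmetric] t_def[symmetric]) (simp add: at)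
          qed
          hence "(\<lambda>v. (v - snd a) / snd w) ` {- \<rho><..<\<rho>} \<subseteq> T" by auto
          moreover have "inj_on (\<lambda>v. (v - snd a) / snd w) {- \<rho><..<\<rho>}"
            using False by (auto simp: inj_on_def)
          ultimately have "infinite T" using strip finite_imageD finite_subset by blast
          thus False using T by auto
        qed
      qed
      have "poly p (of_real t) = 0" if "t \<in> T" for t
        using R_N[OF H_N] that unfolding p T_def by blast
      hence "complex_of_real ` T \<subseteq> {t. poly p t = 0}" by blast
      hence "card (complex_of_real ` T) \<le> card {t. poly p t = 0}"
        by (intro card_mono poly_roots_finite \<open>p \<noteq> 0\<close>)
      also have "\<dots> \<le> degree p" by (rule card_poly_roots_bound[OF \<open>p \<noteq> 0\<close>])
      also have "\<dots> \<le> ?n" unfolding p_def by (intro degree_compose2_le R) (simp_all add: X_def Y_def)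
      finally have "card T \<le> ?n" by (simp add: card_image inj_on_def)
      moreover have T_fin: "finite T" using T by (cases "T = {}") auto
      moreover have "card ((\<lambda>t. a + t *\<^sub>R w) ` T) \<le> card T" by (rule card_image_le[OF T_fin])
      ultimately have "card (?H \<inter> affine_line a w) \<le> ?n" "finite (?H \<inter> affine_line a w)"
        unfolding HT by simp_all
      thus "cardinality (?H \<inter> affine_line a w) \<le> enat ?n" by (simp add: cardinality_def)
    qed
  next
    let ?w = "(1, 0) :: real \<times> real" and ?a = "(0, 0) :: real \<times> real"
    \<comment> \<open>\<open>R / c\<close> is monic in \<open>u\<close> with real roots on the lines near \<open>v = 0\<close>, so there it equals its real part\<close>
    define G where "G = (\<lambda>p. Re (eval2 R (complex_point p) / c))"
    have G: "G (u, v) = (\<Prod>u'\<in>U v. u - u')" if "\<bar>v\<bar> < \<rho>" for u v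
    proof -
      have "eval2 R (complex_point (u, v)) / c = of_real (\<Prod>u'\<in>U v. u - u')"
        using R_prod[OF that, of "of_real u"] \<open>c \<noteq> 0\<close> by (simp add: complex_point_def)
      thus ?thesis by (simp only: G_def Re_complex_of_real)
    qed
    have G_H: "G p = 0" if "p \<in> ?H" for p
      using R_N[OF H_N[OF that]] by (simp add: G_def)
    have H_iff: "(u, v) \<in> ?H \<longleftrightarrow> G (u, v) = 0" if "\<bar>v\<bar> < \<rho>" for u v
      using G_H[of "(u, v)"] G[OF that] U[OF that] by auto
    have line: "?H \<inter> affine_line ?a ?w = (\<lambda>u. (u, 0)) ` U 0"
      using H_iff[of 0] G[of 0] U[of 0] \<open>\<rho> > 0\<close> by (auto simp: affine_line_def)
    have trans: "transversal_at ?H ?w (u, 0)" if u: "u \<in> U 0" for u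
    proof -
      have poly: "real_polynomial_function G"
        unfolding G_def by (rule real_polynomial_function_Re_eval2)
      hence "G differentiable at (u, 0)"
        by (intro differentiable_at_polynomial_function) (simp add: real_polynomial_function_eq[symmetric])
      then obtain D where D: "(G has_derivative D) (at (u, 0))" by (auto simp: differentiable_def)
      have "((\<lambda>x. (x, 0 :: real)) has_derivative (\<lambda>h. (h, 0))) (at u)"
        by (auto intro!: derivative_eq_intros)
      from has_derivative_compose[OF this, of G D] D
      have "((\<lambda>x. G (x, 0)) has_derivative (\<lambda>h. D (h, 0))) (at u)" by simp
      moreover have "((\<lambda>x. G (x, 0)) has_derivative (\<lambda>h. h * (\<Prod>u'\<in>U 0 - {u}. u - u'))) (at u)"
      proof -
        let ?g = "\<lambda>x. \<Prod>u'\<in>U 0 - {u}. x - u'"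
        have "?g differentiable at u"
          by (auto simp: differentiable_def intro!: exI has_derivative_prod derivative_intros)
        then obtain g' where g': "(?g has_derivative g') (at u)" by (auto simp: differentiable_def)
        have "((\<lambda>x. x - u) has_derivative (\<lambda>h. h)) (at u)" by (auto intro!: derivative_eq_intros)
        from has_derivative_mult[OF this g']
        have "((\<lambda>x. (x - u) * ?g x) has_derivative (\<lambda>h. h * ?g u)) (at u)" by simp
        moreover have "G (x, 0) = (x - u) * ?g x" for x
          using G[of 0 x] \<open>\<rho> > 0\<close> U[of 0] u by (simp add: prod.remove)
        ultimately show ?thesis by simp
      qed
      ultimately have "D (1, 0) = 1 * (\<Prod>u'\<in>U 0 - {u}. u - u')"
        by (metis has_derivative_unique)
      also have "\<dots> \<noteq> 0" using U[of 0] \<open>\<rho> > 0\<close> by auto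
      finally have "D ?w \<noteq> 0" .
      moreover have "open {p :: real \<times> real. \<bar>snd p\<bar> < \<rho>}"
        by (intro open_Collect_less continuous_intros)
      moreover have "?H \<inter> {p. \<bar>snd p\<bar> < \<rho>} = {p \<in> {p. \<bar>snd p\<bar> < \<rho>}. G p = 0}"
        using H_iff by auto
      ultimately show ?thesis
        unfolding transversal_at_def using poly G_H D \<open>\<rho> > 0\<close>
        by (intro exI[of _ G] exI[of _ D] exI[of _ "{p. \<bar>snd p\<bar> < \<rho>}"]) auto
    qed
    have "card ((\<lambda>u. (u, 0 :: real)) ` U 0) = ?n" "finite (U 0)"
      using U[of 0] \<open>\<rho> > 0\<close> by (simp_all add: card_image inj_on_def)
    hence "cardinality (?H \<inter> affine_line ?a ?w) = enat ?n"
      unfolding line by (simp add: cardinality_def)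
    moreover have "cardinality (?H \<inter> affine_line ?a ?w) \<le> R_degree ?H"
      unfolding R_degree_def
    proof (rule Sup_upper, rule CollectI, rule exI[of _ ?a], rule exI[of _ ?w], intro conjI)
      show "?w \<noteq> 0" by (simp add: prod_eq_iff)
      show "\<forall>q\<in>?H \<inter> affine_line ?a ?w. transversal_at ?H ?w q"
        unfolding line using trans by auto
    qed (rule refl)
    ultimately show "enat ?n \<le> R_degree ?H" by simp
  qed
  thus ?thesis using curve L_card L_real normals_degree by blast
qed

theorem proposition4p3:
  fixes d :: nat
  assumes "d > 0"
  shows "\<exists>(\<Gamma> :: (real \<times> real) set) (z :: real \<times> real).
     real_algebraic_curve \<Gamma> d \<and>
     card {N \<in> complex_normals \<Gamma>. complex_point z \<in> N} = d\<^sup>2 \<and>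
     {N \<in> complex_normals \<Gamma>. complex_point z \<in> N} \<subseteq> real_normals \<Gamma> \<and>
     has_curve_degree (complex_curve_of_normals \<Gamma>) (d\<^sup>2) \<and>
     R_degree (real_curve_of_normals \<Gamma>) = enat (d\<^sup>2)"
proof -
  show ?thesis
  proof (rule powers_of_two.good_parameters[of d])
    fix \<delta> \<rho> :: real
    assume \<rho>: "0 < \<rho>"
      and normals: "\<And>s. \<bar>s\<bar> < \<rho> \<Longrightarrow> \<exists>U. finite U \<and> card U = d\<^sup>2 \<and>
         (\<forall>u\<in>U. \<exists>x. powers_of_two.normal_foot d \<delta> s u x)"
      and vertical: "\<And>x. \<bar>x\<bar> < \<rho> \<Longrightarrow> \<exists>Y. finite Y \<and> card Y = d \<and>
         (\<forall>y\<in>Y. eval2 (powers_of_two.curve d \<delta>) (x, y) = 0 \<and>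
            eval2 (partial_x (powers_of_two.curve d \<delta>)) (x, y) \<noteq> 0)"
      and horizontal: "\<exists>X. finite X \<and> card X = d \<and>
         (\<forall>x\<in>X. eval2 (powers_of_two.curve d \<delta>) (x, 0) = 0 \<and>
            eval2 (partial_y (powers_of_two.curve d \<delta>)) (x, 0) \<noteq> 0)"
      and nz: "eval2 (powers_of_two.curve d \<delta>) (0, 0) \<noteq> 0"
    show ?thesis
      by (intro exI)
         (rule degree_of_curve_of_normals[OF assms powers_of_two.total_degree_le_curve[of d \<delta>] \<rho>
           normals[unfolded powers_of_two.normal_foot_def] vertical horizontal nz])
  qed
qed

end
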